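(* Let $p,q$ be natural numbers with $pq\ge 6$ and $\Delta^+=\mathbb{Z}_p*\mathbb{Z}_q$. For $n\ge0$ let $s_f(n)$ be the number of free subgroups of index $n$ in $\Delta^+$. Then $$\sum_{n\ge0}s_f(n)\,z^n=\sum_{n\ge0}|\mathfrak{H}^r_{p,q}(n)|\,z^n .$$
   Context: An oriented labelled hypermap on $[n]$ is a triple $\langle [n];\alpha,\varphi\rangle$ with $\alpha,\varphi\in\mathfrak{S}_n$; it is connected if $\langle\alpha,\varphi\rangle$ is transitive on $[n]$, and is a $(p,q)$-hypermap if all disjoint cycles of $\alpha$ have length exactly $p$ and all disjoint cycles of $\varphi$ have length exactly $q$. A rooted hypermap has root dart $1$; two rooted hypermaps are isomorphic if they are simultaneously conjugate by a permutation $\psi\in\mathfrak{S}_n$ with $\psi(1)=1$. $\mathfrak{H}^r_{p,q}(n)$ is the set of isomorphism classes of connected rooted $(p,q)$-hypermaps on $n$ darts ($\mathfrak{H}^r_{p,q}(0)=\emptyset$). *)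

theory Defs
  imports
    "HOL-Algebra.Elementary_Groups"
    "HOL-Algebra.Sym_Groups"
    "HOL-Combinatorics.Orbits"
    "HOL-Computational_Algebra.Formal_Power_Series"
begin

section \<open>Monoids given by generators and relations\<close>

inductive_set word_congruence :: "'a set \<Rightarrow> ('a list \<times> 'a list) set \<Rightarrow> ('a list \<times> 'a list) set"
  for A :: "'a set" and R :: "('a list \<times> 'a list) set" where
  rel: "(u, v) \<in> R \<Longrightarrow> x \<in> lists A \<Longrightarrow> y \<in> lists A \<Longrightarrow> (x @ u @ y, x @ v @ y) \<in> word_congruence A R"
| refl: "w \<in> lists A \<Longrightarrow> (w, w) \<in> word_congruence A R"
| sym: "(u, v) \<in> word_congruence A R \<Longrightarrow> (v, u) \<in> word_congruence A R"
| trans: "(u, v) \<in> word_congruence A R \<Longrightarrow> (v, w) \<in> word_congruence A R \<Longrightarrow> (u, w) \<in> word_congruence A R"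

text \<open>Elements are congruence classes of words over \<open>A\<close>, multiplied by concatenation.
  The relations are meant to be pairs of words over \<open>A\<close>.\<close>

definition word_quotient :: "'a set \<Rightarrow> ('a list \<times> 'a list) set \<Rightarrow> 'a list set monoid" where
  "word_quotient A R =
    \<lparr>carrier = lists A // word_congruence A R,
     monoid.mult = (\<lambda>X Y. word_congruence A R `` {x @ y | x y. x \<in> X \<and> y \<in> Y}),
     one = word_congruence A R `` {[]}\<rparr>"

section \<open>Free products and free groups\<close>

definition free_product_alphabet ::
    "('a, 'c) monoid_scheme \<Rightarrow> ('b, 'd) monoid_scheme \<Rightarrow> ('a + 'b) set" where
  "free_product_alphabet G H = carrier G <+> carrier H"

definition free_product_relations ::
    "('a, 'c) monoid_scheme \<Rightarrow> ('b, 'd) monoid_scheme \<Rightarrow> (('a + 'b) list \<times> ('a + 'b) list) set" where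
  "free_product_relations G H =
    {([Inl x, Inl y], [Inl (x \<otimes>\<^bsub>G\<^esub> y)]) | x y. x \<in> carrier G \<and> y \<in> carrier G} \<union>
    {([Inr x, Inr y], [Inr (x \<otimes>\<^bsub>H\<^esub> y)]) | x y. x \<in> carrier H \<and> y \<in> carrier H} \<union>
    {([Inl \<one>\<^bsub>G\<^esub>], []), ([Inr \<one>\<^bsub>H\<^esub>], [])}"

definition free_product ::
    "('a, 'c) monoid_scheme \<Rightarrow> ('b, 'd) monoid_scheme \<Rightarrow> ('a + 'b) list set monoid" where
  "free_product G H = word_quotient (free_product_alphabet G H) (free_product_relations G H)"

text \<open>The letter \<open>(s, True)\<close> stands for the generator \<open>s\<close>, and \<open>(s, False)\<close> for its inverse.\<close>

definition free_group_on :: "'a set \<Rightarrow> ('a \<times> bool) list set monoid" where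
  "free_group_on S =
    word_quotient (S \<times> UNIV) {([(s, b), (s, \<not> b)], []) | s b. s \<in> S}"

text \<open>A basis of \<open>G\<close> is a subset of \<open>G\<close>, so it is no restriction that \<open>S\<close> has the same element
  type as \<open>G\<close>. The trivial group is free (on the empty set).\<close>

definition is_free_group :: "('a, 'b) monoid_scheme \<Rightarrow> bool" where
  "is_free_group G \<longleftrightarrow> (\<exists>S :: 'a set. G \<cong> free_group_on S)"

section \<open>Free subgroups of finite index\<close>

text \<open>Finiteness of the set of cosets is required explicitly, since \<open>card\<close> is \<open>0\<close> on infinite sets:
  no subgroup has index \<open>0\<close>.\<close>

definition has_index :: "'a set \<Rightarrow> ('a, 'b) monoid_scheme \<Rightarrow> nat \<Rightarrow> bool" where
  "has_index H G n \<longleftrightarrow> finite (rcosets\<^bsub>G\<^esub> H) \<and> card (rcosets\<^bsub>G\<^esub> H) = n"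

definition free_subgroups_of_index :: "('a, 'b) monoid_scheme \<Rightarrow> nat \<Rightarrow> 'a set set" where
  "free_subgroups_of_index G n =
    {H. subgroup H G \<and> is_free_group (G\<lparr>carrier := H\<rparr>) \<and> has_index H G n}"

abbreviation hypermap_group :: "nat \<Rightarrow> nat \<Rightarrow> (int + int) list set monoid" where
  "hypermap_group p q \<equiv> free_product (integer_mod_group p) (integer_mod_group q)"

section \<open>Hypermaps\<close>

text \<open>A labelled hypermap on \<open>{1..n}\<close> is given by its pair of permutations.\<close>

definition labelled_hypermaps :: "nat \<Rightarrow> ((nat \<Rightarrow> nat) \<times> (nat \<Rightarrow> nat)) set" where
  "labelled_hypermaps n = {(\<alpha>, \<phi>). \<alpha> permutes {1..n} \<and> \<phi> permutes {1..n}}"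

definition connected_hypermap :: "nat \<Rightarrow> (nat \<Rightarrow> nat) \<times> (nat \<Rightarrow> nat) \<Rightarrow> bool" where
  "connected_hypermap n = (\<lambda>(\<alpha>, \<phi>).
    \<forall>i\<in>{1..n}. \<forall>j\<in>{1..n}. \<exists>g\<in>generate (sym_group n) {\<alpha>, \<phi>}. g i = j)"

text \<open>The orbits of a permutation on \<open>{1..n}\<close> are the supports of its disjoint cycles; fixed points
  are cycles of length \<open>1\<close>.\<close>

definition all_cycles_have_length :: "nat \<Rightarrow> (nat \<Rightarrow> nat) \<Rightarrow> nat \<Rightarrow> bool" where
  "all_cycles_have_length n \<pi> k \<longleftrightarrow> (\<forall>i\<in>{1..n}. card (orbit \<pi> i) = k)"

text \<open>The root is the dart \<open>1\<close>, so there is no rooted hypermap on \<open>0\<close> darts.\<close>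

definition connected_rooted_hypermaps ::
    "nat \<Rightarrow> nat \<Rightarrow> nat \<Rightarrow> ((nat \<Rightarrow> nat) \<times> (nat \<Rightarrow> nat)) set" where
  "connected_rooted_hypermaps p q n =
    {(\<alpha>, \<phi>) \<in> labelled_hypermaps n.
      1 \<le> n \<and> connected_hypermap n (\<alpha>, \<phi>) \<and>
      all_cycles_have_length n \<alpha> p \<and> all_cycles_have_length n \<phi> q}"

definition rooted_isomorphism ::
    "nat \<Rightarrow> (((nat \<Rightarrow> nat) \<times> (nat \<Rightarrow> nat)) \<times> ((nat \<Rightarrow> nat) \<times> (nat \<Rightarrow> nat))) set" where
  "rooted_isomorphism n =
    {((\<alpha>, \<phi>), (\<alpha>', \<phi>')).
      (\<alpha>, \<phi>) \<in> labelled_hypermaps n \<and> (\<alpha>', \<phi>') \<in> labelled_hypermaps n \<and>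
      (\<exists>\<psi>. \<psi> permutes {1..n} \<and> \<psi> 1 = 1 \<and>
        \<alpha>' = \<psi> \<circ> \<alpha> \<circ> inv' \<psi> \<and> \<phi>' = \<psi> \<circ> \<phi> \<circ> inv' \<psi>)}"

definition rooted_hypermap_classes ::
    "nat \<Rightarrow> nat \<Rightarrow> nat \<Rightarrow> ((nat \<Rightarrow> nat) \<times> (nat \<Rightarrow> nat)) set set" where
  "rooted_hypermap_classes p q n = connected_rooted_hypermaps p q n // rooted_isomorphism n"

section \<open>Well-definedness\<close>

locale word_relations =
  fixes A :: "'a set" and R :: "('a list \<times> 'a list) set"
  assumes R_subset: "R \<subseteq> lists A \<times> lists A"
begin

lemma equiv_word_congruence: "equiv (lists A) (word_congruence A R)"
proof (rule equivI)
  have "u \<in> lists A \<and> v \<in> lists A" if "(u, v) \<in> word_congruence A R" for u v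
    using that by induction (use R_subset in auto)
  then show "word_congruence A R \<subseteq> lists A \<times> lists A" by auto
  show "refl_on (lists A) (word_congruence A R)"
    by (auto intro: refl_onI word_congruence.refl)
qed (auto intro: symI transI word_congruence.sym word_congruence.trans)

lemma word_congruence_append:
  assumes "(u, v) \<in> word_congruence A R" "(u', v') \<in> word_congruence A R"
  shows "(u @ u', v @ v') \<in> word_congruence A R"
proof -
  have left: "(x @ u, x @ v) \<in> word_congruence A R"
    if "(u, v) \<in> word_congruence A R" "x \<in> lists A" for x u v
    using that
  proof (induction)
    case (rel u v x' y')
    then show ?case using word_congruence.rel[of u v R "x @ x'" A y'] by auto
  qed (auto intro!: word_congruence.refl intro: word_congruence.sym word_congruence.trans)
  have right: "(u @ x, v @ x) \<in> word_congruence A R"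
    if "(u, v) \<in> word_congruence A R" "x \<in> lists A" for x u v
    using that
  proof (induction)
    case (rel u v x' y')
    then show ?case using word_congruence.rel[of u v R x' A "y' @ x"] by auto
  qed (auto intro!: word_congruence.refl intro: word_congruence.sym word_congruence.trans)
  have "u' \<in> lists A" "v \<in> lists A"
    using assms equiv_word_congruence by (auto simp: equiv_def)
  then show ?thesis
    using left[OF assms(2), of v] right[OF assms(1), of u'] word_congruence.trans by blast
qed

definition word_class :: "'a list \<Rightarrow> 'a list set" where
  "word_class w = word_congruence A R `` {w}"

lemma word_class_eq_iff:
  "u \<in> lists A \<Longrightarrow> v \<in> lists A \<Longrightarrow> word_class u = word_class v \<longleftrightarrow> (u, v) \<in> word_congruence A R"
  using eq_equiv_class_iff[OF equiv_word_congruence] by (simp add: word_class_def)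

lemma carrier_word_quotient: "carrier (word_quotient A R) = word_class ` lists A"
  by (auto simp: word_quotient_def quotient_def word_class_def)

lemma one_word_quotient: "\<one>\<^bsub>word_quotient A R\<^esub> = word_class []"
  by (simp add: word_quotient_def word_class_def)

lemma mult_word_quotient:
  assumes "u \<in> lists A" "v \<in> lists A"
  shows "word_class u \<otimes>\<^bsub>word_quotient A R\<^esub> word_class v = word_class (u @ v)"
proof -
  have "(u, u) \<in> word_congruence A R" "(v, v) \<in> word_congruence A R"
    using assms by (auto intro: word_congruence.refl)
  then show ?thesis
    by (auto simp: word_quotient_def word_class_def)
      (blast intro: word_congruence_append word_congruence.trans)+
qed

lemma group_word_quotient:
  assumes "\<And>a. a \<in> A \<Longrightarrow> \<exists>w\<in>lists A. (w @ [a], []) \<in> word_congruence A R"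
  shows "group (word_quotient A R)"
proof (rule groupI)
  fix X assume "X \<in> carrier (word_quotient A R)"
  then obtain w where w: "w \<in> lists A" "X = word_class w"
    by (auto simp: carrier_word_quotient)
  have "\<exists>v\<in>lists A. (v @ w, []) \<in> word_congruence A R"
    using w(1)
  proof (induction w)
    case Nil
    then show ?case by (auto intro!: bexI[of _ "[]"] word_congruence.refl)
  next
    case (Cons a w)
    obtain v where v: "v \<in> lists A" "(v @ w, []) \<in> word_congruence A R" using Cons by auto
    obtain b where b: "b \<in> lists A" "(b @ [a], []) \<in> word_congruence A R"
      using assms Cons by blast
    have "(v @ (b @ [a]) @ w, v @ [] @ w) \<in> word_congruence A R"
      by (intro word_congruence_append b word_congruence.refl v Cons)
    then have "((v @ b) @ a # w, []) \<in> word_congruence A R"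
      using word_congruence.trans[OF _ v(2)] by simp
    then show ?case using v b by (metis append_in_lists_conv)
  qed
  then show "\<exists>Y\<in>carrier (word_quotient A R). Y \<otimes>\<^bsub>word_quotient A R\<^esub> X = \<one>\<^bsub>word_quotient A R\<^esub>"
    using w by (auto simp: carrier_word_quotient mult_word_quotient one_word_quotient word_class_eq_iff)
qed (auto simp: carrier_word_quotient mult_word_quotient[OF in_listsI in_listsI]
    one_word_quotient ball_Un intro!: imageI)

lemma finite_subgroups_of_index:
  assumes "finite A" and grp: "group (word_quotient A R)"
  shows "finite {H. subgroup H (word_quotient A R) \<and> has_index H (word_quotient A R) n}"
    (is "finite ?\<H>")
proof -
  define Q where "Q = word_quotient A R"
  interpret Q: group Q using grp by (simp add: Q_def)
  have "\<exists>f. bij_betw f (rcosets\<^bsub>Q\<^esub> H) {0..<n}" if "H \<in> ?\<H>" for H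
    using that ex_bij_betw_finite_nat[of "rcosets\<^bsub>Q\<^esub> H"] by (auto simp: has_index_def Q_def)
  then obtain f where f: "\<And>H. H \<in> ?\<H> \<Longrightarrow> bij_betw (f H) (rcosets\<^bsub>Q\<^esub> H) {0..<n}"
    by metis
  define t where "t H = (\<lambda>(i, a) \<in> {0..<n} \<times> A.
    f H (the_inv_into (rcosets\<^bsub>Q\<^esub> H) (f H) i #>\<^bsub>Q\<^esub> word_class [a]))" for H
  have cl: "word_class w \<in> carrier Q" if "w \<in> lists A" for w
    using that by (auto simp: Q_def carrier_word_quotient)
  have cos: "X #>\<^bsub>Q\<^esub> g \<in> rcosets\<^bsub>Q\<^esub> H" if "H \<in> ?\<H>" "X \<in> rcosets\<^bsub>Q\<^esub> H" "g \<in> carrier Q" for X g H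
  proof -
    have sub: "H \<subseteq> carrier Q" using that subgroup.subset by (auto simp: Q_def)
    from that obtain x where "x \<in> carrier Q" "X = H #>\<^bsub>Q\<^esub> x" by (auto simp: RCOSETS_def)
    then show ?thesis using that sub by (simp add: Q.coset_mult_assoc Q.rcosetsI)
  qed
  have H_coset: "H \<in> rcosets\<^bsub>Q\<^esub> H" if "H \<in> ?\<H>" for H
    using that subgroup.subgroup_in_rcosets[OF _ Q.is_group, of H] by (auto simp: Q_def)
  have t_in: "t H \<in> ({0..<n} \<times> A) \<rightarrow>\<^sub>E {0..<n}" if "H \<in> ?\<H>" for H
  proof -
    have "f H (the_inv_into (rcosets\<^bsub>Q\<^esub> H) (f H) i #>\<^bsub>Q\<^esub> word_class [a]) \<in> {0..<n}"
      if "i \<in> {0..<n}" "a \<in> A" for i a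
    proof -
      have "the_inv_into (rcosets\<^bsub>Q\<^esub> H) (f H) i \<in> rcosets\<^bsub>Q\<^esub> H"
        using bij_betw_the_inv_into[OF f[OF \<open>H \<in> ?\<H>\<close>]] that(1) by (meson bij_betwE)
      then show ?thesis
        using cos[OF \<open>H \<in> ?\<H>\<close> _ cl[of "[a]"]] that(2) f[OF \<open>H \<in> ?\<H>\<close>] by (auto dest: bij_betwE)
    qed
    then show ?thesis by (auto simp: t_def)
  qed
  have fold: "f H (H #>\<^bsub>Q\<^esub> word_class w) = foldl (\<lambda>i a. t H (i, a)) (f H H) w"
    if "H \<in> ?\<H>" "w \<in> lists A" for H w
    using that(2)
  proof (induction w rule: rev_induct)
    case Nil
    have "H \<subseteq> carrier Q" using that subgroup.subset by (auto simp: Q_def)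
    then show ?case using Q.coset_mult_one[of H] by (simp add: Q_def one_word_quotient)
  next
    case (snoc a w)
    let ?X = "H #>\<^bsub>Q\<^esub> word_class w"
    have sub: "H \<subseteq> carrier Q" using that subgroup.subset by (auto simp: Q_def)
    have w: "w \<in> lists A" "a \<in> A" using snoc by auto
    have X: "?X \<in> rcosets\<^bsub>Q\<^esub> H" using cos[OF that(1) H_coset[OF that(1)] cl[OF w(1)]] .
    have "f H ?X \<in> {0..<n}" using f[OF that(1)] X by (auto dest: bij_betwE)
    moreover have "the_inv_into (rcosets\<^bsub>Q\<^esub> H) (f H) (f H ?X) = ?X"
      using f[OF that(1)] X by (simp add: bij_betw_def the_inv_into_f_f)
    moreover have "?X #>\<^bsub>Q\<^esub> word_class [a] = H #>\<^bsub>Q\<^esub> word_class (w @ [a])"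
      using w sub cl by (simp add: Q.coset_mult_assoc) (simp add: Q_def mult_word_quotient)
    ultimately have "t H (f H ?X, a) = f H (H #>\<^bsub>Q\<^esub> word_class (w @ [a]))"
      using w by (simp add: t_def)
    then show ?case using snoc w by simp
  qed
  have H_eq: "H = {word_class w | w. w \<in> lists A \<and> foldl (\<lambda>i a. t H (i, a)) (f H H) w = f H H}"
    if "H \<in> ?\<H>" for H
  proof -
    have H: "subgroup H Q" using that by (simp add: Q_def)
    have inj: "inj_on (f H) (rcosets\<^bsub>Q\<^esub> H)" using f[OF that] by (simp add: bij_betw_def)
    have "word_class w \<in> H \<longleftrightarrow> foldl (\<lambda>i a. t H (i, a)) (f H H) w = f H H" if w: "w \<in> lists A" for w
    proof -
      have "word_class w \<in> H \<longleftrightarrow> H #>\<^bsub>Q\<^esub> word_class w = H"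
        using Q.coset_join1 Q.coset_join2 H cl[OF w] by blast
      also have "\<dots> \<longleftrightarrow> f H (H #>\<^bsub>Q\<^esub> word_class w) = f H H"
        using inj_on_eq_iff[OF inj cos[OF \<open>H \<in> ?\<H>\<close> H_coset[OF \<open>H \<in> ?\<H>\<close>] cl[OF w]]
            H_coset[OF \<open>H \<in> ?\<H>\<close>]] by simp
      finally show ?thesis using fold[OF \<open>H \<in> ?\<H>\<close> w] by simp
    qed
    moreover have "H \<subseteq> word_class ` lists A"
      using subgroup.subset[OF H] by (simp add: Q_def carrier_word_quotient)
    ultimately show ?thesis by blast
  qed
  have "inj_on (\<lambda>H. (t H, f H H)) ?\<H>"
  proof (rule inj_onI)
    fix H K assume HK: "H \<in> ?\<H>" "K \<in> ?\<H>" and "(t H, f H H) = (t K, f K K)"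
    then have "t H = t K" "f H H = f K K" by auto
    then show "H = K" using H_eq[OF HK(1)] H_eq[OF HK(2)] by simp
  qed
  moreover have "(\<lambda>H. (t H, f H H)) ` ?\<H> \<subseteq> (({0..<n} \<times> A) \<rightarrow>\<^sub>E {0..<n}) \<times> {0..<n}"
    using t_in H_coset f by (fastforce dest: bij_betwE)
  moreover have "finite ((({0..<n} \<times> A) \<rightarrow>\<^sub>E {0..<n}) \<times> {0..<n})"
    using \<open>finite A\<close> by (intro finite_cartesian_product finite_PiE) auto
  ultimately show ?thesis by (meson finite_imageD finite_subset)
qed

end

lemma word_relations_free_product:
  assumes "group G" "group H"
  shows "word_relations (free_product_alphabet G H) (free_product_relations G H)"
proof -
  interpret G: group G by fact
  interpret H: group H by fact
  show ?thesis
    by unfold_locales (auto simp: free_product_alphabet_def free_product_relations_def)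
qed

lemma group_free_product:
  assumes "group G" "group H"
  shows "group (free_product G H)"
proof -
  interpret G: group G by fact
  interpret H: group H by fact
  let ?A = "free_product_alphabet G H" and ?R = "free_product_relations G H"
  interpret word_relations ?A ?R by (rule word_relations_free_product[OF assms])
  have step: "(u, v) \<in> ?R \<Longrightarrow> (u, v) \<in> word_congruence ?A ?R" for u v
    using word_congruence.rel[of u v ?R "[]" ?A "[]"] by simp
  have "\<exists>w\<in>lists ?A. (w @ [a], []) \<in> word_congruence ?A ?R" if a: "a \<in> ?A" for a
  proof (cases a)
    case (Inl x)
    then have x: "x \<in> carrier G" using a by (auto simp: free_product_alphabet_def)
    then have "([Inl (inv\<^bsub>G\<^esub> x), Inl x], [Inl (inv\<^bsub>G\<^esub> x \<otimes>\<^bsub>G\<^esub> x)]) \<in> ?R"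
      using G.inv_closed[OF x] unfolding free_product_relations_def by blast
    moreover have "([Inl (inv\<^bsub>G\<^esub> x \<otimes>\<^bsub>G\<^esub> x)], []) \<in> ?R"
      using x by (simp add: free_product_relations_def)
    ultimately have "([Inl (inv\<^bsub>G\<^esub> x)] @ [a], []) \<in> word_congruence ?A ?R"
      using step word_congruence.trans Inl by fastforce
    then show ?thesis
      using x by (intro bexI[of _ "[Inl (inv\<^bsub>G\<^esub> x)]"]) (auto simp: free_product_alphabet_def)
  next
    case (Inr x)
    then have x: "x \<in> carrier H" using a by (auto simp: free_product_alphabet_def)
    then have "([Inr (inv\<^bsub>H\<^esub> x), Inr x], [Inr (inv\<^bsub>H\<^esub> x \<otimes>\<^bsub>H\<^esub> x)]) \<in> ?R"
      using H.inv_closed[OF x] unfolding free_product_relations_def by blast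
    moreover have "([Inr (inv\<^bsub>H\<^esub> x \<otimes>\<^bsub>H\<^esub> x)], []) \<in> ?R"
      using x by (simp add: free_product_relations_def)
    ultimately have "([Inr (inv\<^bsub>H\<^esub> x)] @ [a], []) \<in> word_congruence ?A ?R"
      using step word_congruence.trans Inr by fastforce
    then show ?thesis
      using x by (intro bexI[of _ "[Inr (inv\<^bsub>H\<^esub> x)]"]) (auto simp: free_product_alphabet_def)
  qed
  then show ?thesis unfolding free_product_def by (rule group_word_quotient)
qed

lemma group_free_group_on: "group (free_group_on S)"
proof -
  let ?A = "S \<times> (UNIV :: bool set)" and ?R = "{([(s, b), (s, \<not> b)], []) | s b. s \<in> S}"
  interpret word_relations ?A ?R by unfold_locales auto
  have "\<exists>w\<in>lists ?A. (w @ [a], []) \<in> word_congruence ?A ?R" if a: "a \<in> ?A" for a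
  proof -
    obtain s b where s: "a = (s, b)" "s \<in> S" using a by auto
    have "([(s, \<not> b), (s, \<not> \<not> b)], []) \<in> ?R" using s by blast
    then have "([(s, \<not> b)] @ [a], []) \<in> word_congruence ?A ?R"
      using word_congruence.rel[of "[(s, \<not> b), a]" "[]" ?R "[]" ?A "[]"] s by simp
    then show ?thesis using s by (intro bexI[of _ "[(s, \<not> b)]"]) auto
  qed
  then show ?thesis unfolding free_group_on_def by (rule group_word_quotient)
qed

text \<open>The two numbers compared in the theorem are cardinalities of finite sets.\<close>

lemma finite_free_subgroups_of_index:
  assumes "p > 0" "q > 0"
  shows "finite (free_subgroups_of_index (hypermap_group p q) n)"
proof -
  let ?G = "integer_mod_group p" and ?H = "integer_mod_group q"
  interpret word_relations "free_product_alphabet ?G ?H" "free_product_relations ?G ?H"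
    by (rule word_relations_free_product) auto
  have "finite (free_product_alphabet ?G ?H)"
    using assms by (simp add: free_product_alphabet_def carrier_integer_mod_group)
  then have "finite {H. subgroup H (hypermap_group p q) \<and> has_index H (hypermap_group p q) n}"
    using finite_subgroups_of_index group_free_product[of ?G ?H] by (simp add: free_product_def)
  then show ?thesis
    by (rule rev_finite_subset) (auto simp: free_subgroups_of_index_def)
qed

lemma finite_rooted_hypermap_classes: "finite (rooted_hypermap_classes p q n)"
proof -
  have "labelled_hypermaps n = {\<alpha>. \<alpha> permutes {1..n}} \<times> {\<phi>. \<phi> permutes {1..n}}"
    by (auto simp: labelled_hypermaps_def)
  then have fin: "finite (labelled_hypermaps n)"
    by (simp add: finite_permutations)
  have "connected_rooted_hypermaps p q n \<subseteq> labelled_hypermaps n"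
    by (auto simp: connected_rooted_hypermaps_def)
  moreover have "rooted_isomorphism n \<subseteq> labelled_hypermaps n \<times> labelled_hypermaps n"
    by (auto simp: rooted_isomorphism_def)
  ultimately have "rooted_hypermap_classes p q n \<subseteq> Pow (labelled_hypermaps n)"
    by (auto simp: rooted_hypermap_classes_def quotient_def)
  then show ?thesis using fin by (meson finite_Pow_iff finite_subset)
qed

end

theory Submission
  imports Defs
begin

text \<open>A free subgroup \<open>K\<close> of \<open>P = Z\<^sub>p * Z\<^sub>q\<close> is torsion-free, so in the action of \<open>P\<close>
  on the cosets of \<open>K\<close> the generators of the two factors have only cycles of full lengths \<open>p\<close>
  and \<open>q\<close>; numbering the cosets, with \<open>K\<close> as root, gives a rooted hypermap, which is
  determined up to isomorphism. Conversely, a rooted hypermap is a transitive action of \<open>P\<close> in which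
  the factors act freely, and the stabiliser \<open>K\<close> of the root is free. For this, consider the graph
  whose vertices are the orbits of the two factors and whose edges are the darts, with a spanning
  tree. Give each edge outside the tree a letter as weight: reading off the weights along the closed
  paths defined by the elements of \<open>K\<close> is an isomorphism onto the free group on these letters. Its
  inverse maps a letter to the loop that follows the tree to the corresponding edge, crosses it, and
  returns along the tree.\<close>

section \<open>Actions of groups given by generators and relations\<close>

text \<open>Elements of \<open>free_product\<close> and \<open>free_group_on\<close> are congruence
  classes of words, so a path or a weight cannot be read off an element directly. Maps out of these
  groups are therefore obtained from right actions prescribed on letters: the defining relations are
  checked, and the action is evaluated at one point. Reading off weights must respect the relations
  of both factors. This is why weights sit on half-edges: a move inside one orbit contributes the
  inverse of the weight left behind times the weight reached, and successive moves in that orbit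
  telescope, whatever the weights are. The remaining difficulty is injectivity of the reading map.
  It comes from comparison with right multiplication in \<open>P\<close>: a pair of a coset and a
  collected weight is sent to the product of the loops spelled by the weight, followed by the tree
  path to the coset. This is equivariant, so the loops reproduce each element of \<open>K\<close>
  from its weight. Acyclicity of the tree is expressed by its effect on weights, and is carried
  along while the tree grows vertex by vertex.\<close>

lemma (in group) nat_pow_conj:
  assumes "x \<in> carrier G" "y \<in> carrier G"
  shows "(x \<otimes> y \<otimes> inv x) [^] (m :: nat) = x \<otimes> y [^] m \<otimes> inv x"
proof (induction m)
  case (Suc m)
  have "x \<otimes> y [^] m \<otimes> inv x \<otimes> (x \<otimes> y \<otimes> inv x) = x \<otimes> y [^] m \<otimes> (inv x \<otimes> x) \<otimes> y \<otimes> inv x"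
    using assms by (simp only: m_assoc inv_closed m_closed nat_pow_closed)
  then show ?case using Suc assms by (simp add: m_assoc)
qed (use assms in simp)

context word_relations
begin

abbreviation Q where "Q \<equiv> word_quotient A R"

text \<open>Letters act from the right, since \<open>foldl\<close> reads a word from left to right.
  The relations are demanded at points of \<Omega>; elsewhere the maps are arbitrary.\<close>

definition acts_on :: "'s set \<Rightarrow> ('s \<Rightarrow> 'a \<Rightarrow> 's) \<Rightarrow> bool" where
  "acts_on \<Omega> t \<longleftrightarrow> (\<forall>s\<in>\<Omega>. \<forall>a\<in>A. t s a \<in> \<Omega>) \<and>
    (\<forall>(u, v)\<in>R. \<forall>s\<in>\<Omega>. foldl t s u = foldl t s v)"

definition act :: "('s \<Rightarrow> 'a \<Rightarrow> 's) \<Rightarrow> 's \<Rightarrow> 'a list set \<Rightarrow> 's" where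
  "act t s X = foldl t s (SOME w. w \<in> X)"

lemma word_class_closed [simp, intro]: "w \<in> lists A \<Longrightarrow> word_class w \<in> carrier Q"
  by (simp add: carrier_word_quotient)

lemma foldl_closed:
  assumes "acts_on \<Omega> t" "s \<in> \<Omega>" "w \<in> lists A"
  shows "foldl t s w \<in> \<Omega>"
  using assms(3,2) by (induction w arbitrary: s) (use assms(1) in \<open>auto simp: acts_on_def\<close>)

lemma foldl_congruence:
  assumes "acts_on \<Omega> t" "(u, v) \<in> word_congruence A R" "s \<in> \<Omega>"
  shows "foldl t s u = foldl t s v"
  using assms(2,3)
proof (induction arbitrary: s)
  case (rel u v x y)
  have "foldl t s x \<in> \<Omega>"
    using foldl_closed[OF assms(1)] rel by blast
  then have "foldl t (foldl t s x) u = foldl t (foldl t s x) v"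
    using assms(1) rel by (auto simp: acts_on_def)
  then show ?case by simp
qed auto

lemma act_word_class:
  assumes "acts_on \<Omega> t" "s \<in> \<Omega>" "w \<in> lists A"
  shows "act t s (word_class w) = foldl t s w"
proof -
  have "w \<in> word_class w"
    using assms(3) by (simp add: word_class_def word_congruence.refl)
  then have "(SOME v. v \<in> word_class w) \<in> word_class w"
    by (rule someI)
  then have "(w, SOME v. v \<in> word_class w) \<in> word_congruence A R"
    unfolding word_class_def by simp
  then show ?thesis
    using foldl_congruence[OF assms(1) _ assms(2)] by (simp add: act_def)
qed

lemma carrier_cases:
  assumes "g \<in> carrier Q"
  obtains w where "w \<in> lists A" "g = word_class w"
  using assms by (auto simp: carrier_word_quotient)

lemma act_closed:
  assumes "acts_on \<Omega> t" "s \<in> \<Omega>" "g \<in> carrier Q"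
  shows "act t s g \<in> \<Omega>"
  using assms(3) by (rule carrier_cases) (simp add: act_word_class[OF assms(1,2)] foldl_closed[OF assms(1,2)])

lemma act_one:
  assumes "acts_on \<Omega> t" "s \<in> \<Omega>"
  shows "act t s \<one>\<^bsub>Q\<^esub> = s"
  using act_word_class[OF assms, of "[]"] by (simp add: one_word_quotient)

lemma act_letter:
  assumes "acts_on \<Omega> t" "s \<in> \<Omega>" "a \<in> A"
  shows "act t s (word_class [a]) = t s a"
  using act_word_class[OF assms(1,2), of "[a]"] assms(3) by simp

lemma act_mult:
  assumes "acts_on \<Omega> t" "s \<in> \<Omega>" "g \<in> carrier Q" "h \<in> carrier Q"
  shows "act t s (g \<otimes>\<^bsub>Q\<^esub> h) = act t (act t s g) h"
proof -
  obtain u where u: "u \<in> lists A" "g = word_class u" using assms(3) by (rule carrier_cases)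
  obtain v where v: "v \<in> lists A" "h = word_class v" using assms(4) by (rule carrier_cases)
  have "u @ v \<in> lists A" using u v by simp
  then show ?thesis
    using u v assms foldl_closed[OF assms(1,2) u(1)]
    by (simp add: mult_word_quotient act_word_class[OF assms(1)] del: append_in_lists_conv)
qed

text \<open>Equivariance propagates from letters to words. Projections, left translations,
  numberings of cosets and the comparison with right multiplication are all instances.\<close>

lemma act_morphism:
  assumes "acts_on \<Omega> t" "acts_on \<Omega>' t'"
    and f: "\<And>s. s \<in> \<Omega> \<Longrightarrow> f s \<in> \<Omega>'"
    and eq: "\<And>s a. s \<in> \<Omega> \<Longrightarrow> a \<in> A \<Longrightarrow> f (t s a) = t' (f s) a"
    and "s \<in> \<Omega>" "g \<in> carrier Q"
  shows "f (act t s g) = act t' (f s) g"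
proof -
  obtain w where w: "w \<in> lists A" "g = word_class w" using assms(6) by (rule carrier_cases)
  have "f (foldl t s w) = foldl t' (f s) w"
    using w(1) \<open>s \<in> \<Omega>\<close>
  proof (induction w arbitrary: s)
    case (Cons a w)
    then have "t s a \<in> \<Omega>" using assms(1) by (simp add: acts_on_def)
    then show ?case using Cons eq by simp
  qed simp
  then show ?thesis
    using w act_word_class[OF assms(1,5)] act_word_class[OF assms(2) f[OF assms(5)]] by simp
qed

lemma carrier_induct [consumes 1, case_names one snoc]:
  assumes "g \<in> carrier Q" "P \<one>\<^bsub>Q\<^esub>"
    and "\<And>g a. g \<in> carrier Q \<Longrightarrow> a \<in> A \<Longrightarrow> P g \<Longrightarrow> P (g \<otimes>\<^bsub>Q\<^esub> word_class [a])"
  shows "P g"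
proof -
  obtain w where w: "w \<in> lists A" "g = word_class w" using assms(1) by (rule carrier_cases)
  have "P (word_class w)"
    using w(1)
  proof (induction w rule: rev_induct)
    case Nil
    then show ?case using assms(2) by (simp add: one_word_quotient)
  next
    case (snoc a w)
    then show ?case
      using assms(3)[of "word_class w" a] mult_word_quotient[of w "[a]"] by auto
  qed
  then show ?thesis using w by simp
qed

text \<open>A right action of the whole group is recovered from its restriction to letters. With the
  next two lemmas, this turns multiplication in the group and on cosets into actions in the sense of
  \<open>acts_on\<close>.\<close>

lemma foldl_of_action:
  assumes "\<And>s. s \<in> \<Omega> \<Longrightarrow> m s \<one>\<^bsub>Q\<^esub> = s"
    and "\<And>s g. s \<in> \<Omega> \<Longrightarrow> g \<in> carrier Q \<Longrightarrow> m s g \<in> \<Omega>"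
    and "\<And>s g h. s \<in> \<Omega> \<Longrightarrow> g \<in> carrier Q \<Longrightarrow> h \<in> carrier Q \<Longrightarrow>
      m s (g \<otimes>\<^bsub>Q\<^esub> h) = m (m s g) h"
    and "s \<in> \<Omega>" "w \<in> lists A"
  shows "foldl (\<lambda>s a. m s (word_class [a])) s w = m s (word_class w)"
  using assms(5)
proof (induction w rule: rev_induct)
  case Nil
  then show ?case using assms(1,4) by (simp add: one_word_quotient)
next
  case (snoc a w)
  then have a: "a \<in> A" "w \<in> lists A" by auto
  then show ?case
    using snoc assms(3)[of s "word_class w" "word_class [a]"] assms(4)
      mult_word_quotient[of w "[a]"] by auto
qed

lemma acts_on_of_action:
  assumes "\<And>s. s \<in> \<Omega> \<Longrightarrow> m s \<one>\<^bsub>Q\<^esub> = s"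
    and "\<And>s g. s \<in> \<Omega> \<Longrightarrow> g \<in> carrier Q \<Longrightarrow> m s g \<in> \<Omega>"
    and "\<And>s g h. s \<in> \<Omega> \<Longrightarrow> g \<in> carrier Q \<Longrightarrow> h \<in> carrier Q \<Longrightarrow>
      m s (g \<otimes>\<^bsub>Q\<^esub> h) = m (m s g) h"
  shows "acts_on \<Omega> (\<lambda>s a. m s (word_class [a]))"
  unfolding acts_on_def
proof (intro conjI ballI, safe)
  fix u v s assume uv: "(u, v) \<in> R" and s: "s \<in> \<Omega>"
  then have l: "u \<in> lists A" "v \<in> lists A" using R_subset by auto
  have "(u, v) \<in> word_congruence A R"
    using word_congruence.rel[OF uv, of "[]" A "[]"] by simp
  then have "word_class u = word_class v" using word_class_eq_iff l by blast
  then show "foldl (\<lambda>s a. m s (word_class [a])) s u = foldl (\<lambda>s a. m s (word_class [a])) s v"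
    using foldl_of_action[of \<Omega> m, OF assms s] l by simp
qed (use assms(2) in auto)

lemma act_of_action:
  assumes "\<And>s. s \<in> \<Omega> \<Longrightarrow> m s \<one>\<^bsub>Q\<^esub> = s"
    and "\<And>s g. s \<in> \<Omega> \<Longrightarrow> g \<in> carrier Q \<Longrightarrow> m s g \<in> \<Omega>"
    and "\<And>s g h. s \<in> \<Omega> \<Longrightarrow> g \<in> carrier Q \<Longrightarrow> h \<in> carrier Q \<Longrightarrow>
      m s (g \<otimes>\<^bsub>Q\<^esub> h) = m (m s g) h"
    and "s \<in> \<Omega>" "g \<in> carrier Q"
  shows "act (\<lambda>s a. m s (word_class [a])) s g = m s g"
proof -
  obtain w where w: "w \<in> lists A" "g = word_class w" using assms(5) by (rule carrier_cases)
  have "acts_on \<Omega> (\<lambda>s a. m s (word_class [a]))"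
    by (rule acts_on_of_action) (use assms in auto)
  then show ?thesis
    using act_word_class[OF _ assms(4) w(1)] foldl_of_action[of \<Omega> m, OF assms(1-4) w(1)] w(2)
    by auto
qed

end

section \<open>Free groups are torsion-free\<close>

locale free_group_basis =
  fixes S :: "'a set"
begin

abbreviation letters where "letters \<equiv> S \<times> (UNIV :: bool set)"
definition cancellations where "cancellations = {([(s, b), (s, \<not> b)], []) | s b. s \<in> S}"
abbreviation F where "F \<equiv> free_group_on S"

sublocale word_relations letters cancellations
  by unfold_locales (auto simp: cancellations_def)

sublocale F: group F
  by (rule group_free_group_on)

lemma F_def: "F = word_quotient letters cancellations"
  by (simp add: free_group_on_def cancellations_def)

definition gen :: "'a \<Rightarrow> ('a \<times> bool) list set" where
  "gen s = word_class [(s, True)]"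

lemma gen_closed [simp, intro]: "s \<in> S \<Longrightarrow> gen s \<in> carrier F"
  by (auto simp: gen_def F_def)

lemma cancel: "s \<in> S \<Longrightarrow> u \<in> lists letters \<Longrightarrow> v \<in> lists letters \<Longrightarrow>
    word_class (u @ [(s, b), (s, \<not> b)] @ v) = word_class (u @ v)"
  using word_congruence.rel[of "[(s, b), (s, \<not> b)]" "[]" cancellations u letters v]
  by (subst word_class_eq_iff) (auto simp: cancellations_def)

lemma letter_mult_inverse:
  "s \<in> S \<Longrightarrow> word_class [(s, b)] \<otimes>\<^bsub>F\<^esub> word_class [(s, \<not> b)] = \<one>\<^bsub>F\<^esub>"
  using cancel[of s "[]" "[]" b] by (simp add: F_def mult_word_quotient one_word_quotient)

lemma inv_gen: "s \<in> S \<Longrightarrow> inv\<^bsub>F\<^esub> (gen s) = word_class [(s, False)]"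
  using letter_mult_inverse[of s False] by (intro F.inv_equality) (auto simp: gen_def F_def)

lemma subgroup_UNIV:
  assumes K: "subgroup K F" and "\<And>s. s \<in> S \<Longrightarrow> gen s \<in> K"
  shows "K = carrier F"
proof (rule antisym)
  show "K \<subseteq> carrier F" using K by (rule subgroup.subset)
  show "carrier F \<subseteq> K"
  proof
    fix g assume "g \<in> carrier F"
    then show "g \<in> K"
      unfolding F_def
    proof (induction rule: carrier_induct)
      case one
      then show ?case using subgroup.one_closed[OF K] by (simp add: F_def)
    next
      case (snoc g a)
      obtain s b where a: "a = (s, b)" "s \<in> S" using snoc by auto
      have "word_class [a] \<in> K"
        using a assms(2)[of s] subgroup.m_inv_closed[OF K, of "gen s"] inv_gen[of s]
        by (cases b) (auto simp: gen_def)
      then show ?case using snoc subgroup.m_closed[OF K] by (simp add: F_def)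
    qed
  qed
qed

text \<open>The universal property of the free group. \<open>F\<close> acts on \<open>M\<close> by
  right multiplication with the prescribed images; left multiplications commute with this action, so
  the orbit map of the unit is multiplicative.\<close>

lemma lift_hom:
  assumes "group M" and e: "\<And>s. s \<in> S \<Longrightarrow> e s \<in> carrier M"
  obtains h where "h \<in> hom F M" "\<And>s. s \<in> S \<Longrightarrow> h (gen s) = e s"
proof -
  interpret M: group M by fact
  define t where "t m = (\<lambda>(s, b). m \<otimes>\<^bsub>M\<^esub> (if b then e s else inv\<^bsub>M\<^esub> e s))" for m
  have t: "acts_on (carrier M) t"
    using e unfolding acts_on_def by (auto simp: t_def M.m_assoc cancellations_def)
  have left: "m \<otimes>\<^bsub>M\<^esub> act t m' g = act t (m \<otimes>\<^bsub>M\<^esub> m') g"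
    if "m \<in> carrier M" "m' \<in> carrier M" "g \<in> carrier F" for m m' g
    using that e
    by (intro act_morphism[OF t t, where f = "\<lambda>x. m \<otimes>\<^bsub>M\<^esub> x"]) (auto simp: F_def t_def M.m_assoc)
  show thesis
  proof
    show "act t \<one>\<^bsub>M\<^esub> \<in> hom F M"
    proof (rule homI)
      fix g h assume gh: "g \<in> carrier F" "h \<in> carrier F"
      have c: "act t \<one>\<^bsub>M\<^esub> g \<in> carrier M" using act_closed[OF t] gh by (simp add: F_def)
      have "act t \<one>\<^bsub>M\<^esub> (g \<otimes>\<^bsub>F\<^esub> h) = act t (act t \<one>\<^bsub>M\<^esub> g) h"
        using act_mult[OF t] gh by (simp add: F_def)
      also have "\<dots> = act t \<one>\<^bsub>M\<^esub> g \<otimes>\<^bsub>M\<^esub> act t \<one>\<^bsub>M\<^esub> h"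
        using left[OF c M.one_closed gh(2)] c by simp
      finally show "act t \<one>\<^bsub>M\<^esub> (g \<otimes>\<^bsub>F\<^esub> h) = act t \<one>\<^bsub>M\<^esub> g \<otimes>\<^bsub>M\<^esub> act t \<one>\<^bsub>M\<^esub> h" .
    qed (use act_closed[OF t] in \<open>simp add: F_def\<close>)
    show "act t \<one>\<^bsub>M\<^esub> (gen s) = e s" if "s \<in> S" for s
      using act_letter[OF t, of "\<one>\<^bsub>M\<^esub>" "(s, True)"] that e by (simp add: gen_def t_def)
  qed
qed

section \<open>Reduced words in a free group\<close>

definition flip :: "'a \<times> bool \<Rightarrow> 'a \<times> bool" where
  "flip = apsnd Not"

lemma flip_simps [simp]: "flip (s, b) = (s, \<not> b)" "flip (flip x) = x" "flip x \<noteq> x"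
  by (auto simp: flip_def apsnd_def map_prod_def split: prod.splits)

definition reduced :: "('a \<times> bool) list \<Rightarrow> bool" where
  "reduced = successively (\<lambda>x y. y \<noteq> flip x)"

text \<open>A stack holds a reduced word with its last letter on top, so that multiplication by a
  letter on the right changes only the head of the list.\<close>

definition push :: "('a \<times> bool) list \<Rightarrow> 'a \<times> bool \<Rightarrow> ('a \<times> bool) list" where
  "push st a = (case st of [] \<Rightarrow> [a] | b # r \<Rightarrow> if b = flip a then r else a # st)"

text \<open>Van der Waerden's argument: the free group acts on reduced words. Pushing a letter and
  then its inverse restores the stack, because reducedness forbids a further cancellation once a top
  has been removed.\<close>

lemma acts_on_push: "acts_on {w \<in> lists letters. reduced w} push"
proof -
  have "push (push st (s, b)) (s, \<not> b) = st" if "reduced st" for st s b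
    using that
    by (cases st rule: remdups_adj.cases) (auto simp: push_def reduced_def)
  moreover have "reduced (push st a)" if "reduced st" for st a
    using that
    by (cases st rule: remdups_adj.cases) (auto simp: push_def reduced_def)
  moreover have "push st a \<in> lists letters" if "st \<in> lists letters" "a \<in> letters" for st a
    using that by (auto simp: push_def split: list.splits)
  ultimately show ?thesis unfolding acts_on_def by (auto simp: cancellations_def)
qed

lemma foldl_push:
  "reduced (rev st @ w) \<Longrightarrow> foldl push st w = rev w @ st"
proof (induction w arbitrary: st)
  case (Cons a w)
  have "push st a = a # st"
    using Cons.prems
    by (cases st) (auto simp: push_def reduced_def successively_append_iff)
  then show ?case using Cons.IH[of "a # st"] Cons.prems by simp
qed simp

text \<open>Acting on the empty stack, a reduced word merely piles up its letters, whereas the unit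
  leaves the stack empty.\<close>

lemma reduced_eq_one:
  assumes "w \<in> lists letters" "reduced w" "word_class w = \<one>\<^bsub>F\<^esub>"
  shows "w = []"
proof -
  have r: "[] \<in> {w \<in> lists letters. reduced w}" by (simp add: reduced_def)
  have "foldl push [] w = act push [] (word_class w)"
    using act_word_class[OF acts_on_push r assms(1)] by simp
  also have "\<dots> = []"
    using act_one[OF acts_on_push r] assms(3) by (simp add: F_def)
  finally show ?thesis using foldl_push[of "[]" w] assms(2) by simp
qed

lemma not_reduced_split:
  "\<not> reduced w \<Longrightarrow> \<exists>u s b v. w = u @ [(s, b), (s, \<not> b)] @ v"
proof (induction w rule: remdups_adj.induct)
  case (3 x y w)
  show ?case
  proof (cases "y = flip x")
    case True
    then show ?thesis by (cases x) (force intro: exI[of _ "[]"])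
  next
    case False
    then have "\<not> reduced (y # w)" using 3 by (simp add: reduced_def)
    then obtain u s b v where "y # w = u @ [(s, b), (s, \<not> b)] @ v"
      using 3 by (metis (full_types))
    then show ?thesis by (metis append_Cons)
  qed
qed (auto simp: reduced_def)

lemma word_class_power:
  "w \<in> lists letters \<Longrightarrow> word_class (concat (replicate m w)) = word_class w [^]\<^bsub>F\<^esub> m"
proof (induction m)
  case (Suc m)
  have "concat (replicate m w) \<in> lists letters" using Suc by (induction m) auto
  moreover have "word_class w \<in> carrier F" using Suc by (simp add: F_def)
  ultimately show ?case
    using Suc F.nat_pow_Suc2[of "word_class w" m] mult_word_quotient[of w "concat (replicate m w)"]
    by (simp flip: F_def)
qed (simp add: F_def one_word_quotient)

text \<open>A shortest nontrivial word with trivial \<open>m\<close>-th power would be cyclically reduced, and then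
  its powers are reduced as well.\<close>

lemma torsion_free:
  assumes "g \<in> carrier F" "g [^]\<^bsub>F\<^esub> (m :: nat) = \<one>\<^bsub>F\<^esub>" "m > 0"
  shows "g = \<one>\<^bsub>F\<^esub>"
proof (rule ccontr)
  assume "g \<noteq> \<one>\<^bsub>F\<^esub>"
  define B where "B w \<longleftrightarrow> w \<in> lists letters \<and> word_class w [^]\<^bsub>F\<^esub> m = \<one>\<^bsub>F\<^esub> \<and> word_class w \<noteq> \<one>\<^bsub>F\<^esub>" for w
  obtain w0 where "w0 \<in> lists letters" "g = word_class w0"
    using assms(1) unfolding F_def by (rule carrier_cases)
  then have "B w0" using assms \<open>g \<noteq> \<one>\<^bsub>F\<^esub>\<close> by (simp add: B_def)
  then obtain w where w: "B w" and min: "\<And>v. B v \<Longrightarrow> length w \<le> length v"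
    using ex_has_least_nat[of B w0 length] by blast
  have wl: "w \<in> lists letters" using w by (simp add: B_def)
  have wne: "w \<noteq> []" using w by (metis B_def F_def one_word_quotient)
  have red: "reduced w"
  proof (rule ccontr)
    assume "\<not> reduced w"
    then obtain u s b v where eq: "w = u @ [(s, b), (s, \<not> b)] @ v"
      using not_reduced_split by blast
    then have "word_class (u @ v) = word_class w" using cancel[of s u v b] wl by auto
    then have "B (u @ v)" using w eq by (auto simp: B_def)
    then show False using min[of "u @ v"] eq by simp
  qed
  \<comment> \<open>Otherwise \<open>w\<close> is a conjugate of the shorter word obtained by
    deleting both ends; that word is again nontrivial with trivial \<open>m\<close>-th power,
    against minimality.\<close>
  have cyc: "hd w \<noteq> flip (last w)"
  proof
    assume h: "hd w = flip (last w)"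
    obtain a v where av: "w = a # v" using wne by (cases w) auto
    with h have "v \<noteq> []" by (metis flip_simps(3) last_ConsL list.sel(1))
    then obtain v' c where c: "v = v' @ [c]" by (metis append_butlast_last_id)
    obtain s b where sb: "a = (s, b)" by fastforce
    with h av c have cs: "c = (s, \<not> b)" by (cases c) auto
    have l: "s \<in> S" "v' \<in> lists letters" using wl av c sb by auto
    let ?a = "word_class [(s, b)]" and ?a' = "word_class [(s, \<not> b)]" and ?x = "word_class v'"
    have cl: "?a \<in> carrier F" "?a' \<in> carrier F" "?x \<in> carrier F" using l by (auto simp: F_def)
    have a'a: "?a' \<otimes>\<^bsub>F\<^esub> ?a = \<one>\<^bsub>F\<^esub>" using letter_mult_inverse[of s "\<not> b"] l by simp
    have aa': "?a \<otimes>\<^bsub>F\<^esub> ?a' = \<one>\<^bsub>F\<^esub>" using letter_mult_inverse[of s b] l by simp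
    have wx: "word_class w = ?a \<otimes>\<^bsub>F\<^esub> ?x \<otimes>\<^bsub>F\<^esub> ?a'"
      using l av c cs sb by (simp add: F_def mult_word_quotient)
    have xw: "?x = ?a' \<otimes>\<^bsub>F\<^esub> word_class w \<otimes>\<^bsub>F\<^esub> ?a"
    proof -
      have "?a' \<otimes>\<^bsub>F\<^esub> word_class w \<otimes>\<^bsub>F\<^esub> ?a = (?a' \<otimes>\<^bsub>F\<^esub> ?a) \<otimes>\<^bsub>F\<^esub> ?x \<otimes>\<^bsub>F\<^esub> (?a' \<otimes>\<^bsub>F\<^esub> ?a)"
        unfolding wx using cl by (simp add: F.m_assoc)
      then show ?thesis using cl by (simp add: a'a)
    qed
    have "word_class w \<in> carrier F" using wl by (simp add: F_def)
    moreover have "inv\<^bsub>F\<^esub> ?a' = ?a" using cl aa' by (intro F.inv_equality) auto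
    ultimately have "?x [^]\<^bsub>F\<^esub> m = \<one>\<^bsub>F\<^esub>"
      using w cl a'a F.nat_pow_conj[of ?a' "word_class w" m] by (simp add: xw B_def)
    moreover have "?x \<noteq> \<one>\<^bsub>F\<^esub>"
      using wx w aa' cl by (auto simp: B_def)
    ultimately have "B v'" using l by (auto simp: B_def)
    then show False using min[of v'] av c by simp
  qed
  \<comment> \<open>The first letter is tracked so that \<open>cyc\<close> applies at the junction
    between \<open>w\<close> and the next copies.\<close>
  have "reduced (concat (replicate k w)) \<and> (k > 0 \<longrightarrow> hd (concat (replicate k w)) = hd w)" for k
  proof (induction k)
    case (Suc k)
    then show ?case
      using red cyc wne by (cases k) (auto simp: reduced_def successively_append_iff)
  qed (simp add: reduced_def)
  moreover have "concat (replicate m w) \<in> lists letters" using wl by (induction m) auto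
  moreover have "word_class (concat (replicate m w)) = \<one>\<^bsub>F\<^esub>"
    using w word_class_power[OF wl] by (simp add: B_def)
  ultimately have "concat (replicate m w) = []" using reduced_eq_one by blast
  then show False using \<open>m > 0\<close> wne by (cases m) auto
qed

end

lemma is_free_group_torsion_free:
  assumes "group G" "is_free_group G" "g \<in> carrier G" "g [^]\<^bsub>G\<^esub> (m :: nat) = \<one>\<^bsub>G\<^esub>" "m > 0"
  shows "g = \<one>\<^bsub>G\<^esub>"
proof -
  from assms(2) obtain S :: "'a set" and h where h: "h \<in> iso G (free_group_on S)"
    by (auto simp: is_free_group_def is_iso_def)
  interpret free_group_basis S .
  interpret group_hom G F h
    using h assms(1) F.is_group by (auto simp: group_hom_def group_hom_axioms_def iso_def)
  have "h g [^]\<^bsub>F\<^esub> m = \<one>\<^bsub>F\<^esub>" using assms(3,4) hom_nat_pow by (metis hom_one)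
  then have "h g = h \<one>\<^bsub>G\<^esub>" using torsion_free[of "h g" m] assms by (simp del: hom_one add: hom_one[symmetric])
  then show ?thesis
    using h assms(3) inj_onD[of h "carrier G" g "\<one>\<^bsub>G\<^esub>"] by (auto simp: iso_def bij_betw_def)
qed

section \<open>Free products\<close>

locale free_product_of_groups = G: group G + H: group H
  for G :: "('a, 'c) monoid_scheme" and H :: "('b, 'd) monoid_scheme"
begin

abbreviation P where "P \<equiv> free_product G H"
abbreviation letters where "letters \<equiv> free_product_alphabet G H"

sublocale word_relations letters "free_product_relations G H"
  by (rule word_relations_free_product[OF G.is_group H.is_group])

sublocale P: group P
  by (rule group_free_product[OF G.is_group H.is_group])

lemma P_def: "P = word_quotient letters (free_product_relations G H)"
  by (simp add: free_product_def)

lemmas act_closed' = act_closed[folded P_def]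
  and act_one' = act_one[folded P_def]
  and act_mult' = act_mult[folded P_def]
  and act_morphism' = act_morphism[folded P_def]
  and mult_word_class = mult_word_quotient[folded P_def]
  and one_word_class = one_word_quotient[folded P_def]

definition letter :: "'a + 'b \<Rightarrow> ('a + 'b) list set" where
  "letter a = word_class [a]"

lemma letter_closed [simp, intro]: "a \<in> letters \<Longrightarrow> letter a \<in> carrier P"
  by (auto simp: letter_def P_def)

lemma Inl_in_letters [simp]: "Inl x \<in> letters \<longleftrightarrow> x \<in> carrier G"
  and Inr_in_letters [simp]: "Inr y \<in> letters \<longleftrightarrow> y \<in> carrier H"
  by (auto simp: free_product_alphabet_def)

lemma acts_onI:
  assumes "\<And>s a. s \<in> \<Omega> \<Longrightarrow> a \<in> letters \<Longrightarrow> t s a \<in> \<Omega>"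
    and "\<And>s x y. s \<in> \<Omega> \<Longrightarrow> x \<in> carrier G \<Longrightarrow> y \<in> carrier G \<Longrightarrow>
      t (t s (Inl x)) (Inl y) = t s (Inl (x \<otimes>\<^bsub>G\<^esub> y))"
    and "\<And>s x y. s \<in> \<Omega> \<Longrightarrow> x \<in> carrier H \<Longrightarrow> y \<in> carrier H \<Longrightarrow>
      t (t s (Inr x)) (Inr y) = t s (Inr (x \<otimes>\<^bsub>H\<^esub> y))"
    and "\<And>s. s \<in> \<Omega> \<Longrightarrow> t s (Inl \<one>\<^bsub>G\<^esub>) = s" "\<And>s. s \<in> \<Omega> \<Longrightarrow> t s (Inr \<one>\<^bsub>H\<^esub>) = s"
  shows "acts_on \<Omega> t"
  unfolding acts_on_def using assms by (auto simp: free_product_relations_def)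

lemma letter_relation:
  "(u, v) \<in> free_product_relations G H \<Longrightarrow> word_class u = word_class v"
  using word_congruence.rel[of u v "free_product_relations G H" "[]" letters "[]"] R_subset
  by (subst word_class_eq_iff) auto

lemma letter_one: "letter (Inl \<one>\<^bsub>G\<^esub>) = \<one>\<^bsub>P\<^esub>" "letter (Inr \<one>\<^bsub>H\<^esub>) = \<one>\<^bsub>P\<^esub>"
proof -
  have "([Inl \<one>\<^bsub>G\<^esub>], []) \<in> free_product_relations G H" "([Inr \<one>\<^bsub>H\<^esub>], []) \<in> free_product_relations G H"
    by (auto simp: free_product_relations_def)
  then show "letter (Inl \<one>\<^bsub>G\<^esub>) = \<one>\<^bsub>P\<^esub>" "letter (Inr \<one>\<^bsub>H\<^esub>) = \<one>\<^bsub>P\<^esub>"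
    using letter_relation by (simp_all add: letter_def one_word_class)
qed

lemma letter_mult:
  "x \<in> carrier G \<Longrightarrow> y \<in> carrier G \<Longrightarrow>
    letter (Inl x) \<otimes>\<^bsub>P\<^esub> letter (Inl y) = letter (Inl (x \<otimes>\<^bsub>G\<^esub> y))"
  "z \<in> carrier H \<Longrightarrow> w \<in> carrier H \<Longrightarrow>
    letter (Inr z) \<otimes>\<^bsub>P\<^esub> letter (Inr w) = letter (Inr (z \<otimes>\<^bsub>H\<^esub> w))"
proof -
  show "letter (Inl x) \<otimes>\<^bsub>P\<^esub> letter (Inl y) = letter (Inl (x \<otimes>\<^bsub>G\<^esub> y))"
    if "x \<in> carrier G" "y \<in> carrier G"
  proof -
    have "([Inl x, Inl y], [Inl (x \<otimes>\<^bsub>G\<^esub> y)]) \<in> free_product_relations G H"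
      using that unfolding free_product_relations_def by blast
    then show ?thesis
      using letter_relation mult_word_class[of "[Inl x]" "[Inl y]"] that
      by (simp add: letter_def)
  qed
  show "letter (Inr z) \<otimes>\<^bsub>P\<^esub> letter (Inr w) = letter (Inr (z \<otimes>\<^bsub>H\<^esub> w))"
    if "z \<in> carrier H" "w \<in> carrier H"
  proof -
    have "([Inr z, Inr w], [Inr (z \<otimes>\<^bsub>H\<^esub> w)]) \<in> free_product_relations G H"
      using that unfolding free_product_relations_def by blast
    then show ?thesis
      using letter_relation mult_word_class[of "[Inr z]" "[Inr w]"] that
      by (simp add: letter_def)
  qed
qed

text \<open>\<open>factor True\<close> is the image of \<open>G\<close>, and \<open>factor False\<close> the image of \<open>H\<close>.\<close>

definition factor :: "bool \<Rightarrow> ('a + 'b) list set set" where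
  "factor s = letter ` {a \<in> letters. isl a = s}"

lemma factor_closed: "g \<in> factor s \<Longrightarrow> g \<in> carrier P"
  by (auto simp: factor_def)

lemma subgroup_factor: "subgroup (factor s) P"
proof -
  have T: "factor True = (\<lambda>x. letter (Inl x)) ` carrier G"
    and F: "factor False = (\<lambda>x. letter (Inr x)) ` carrier H"
    by (force simp: factor_def free_product_alphabet_def)+
  have homs: "(\<lambda>x. letter (Inl x)) \<in> hom G P" "(\<lambda>x. letter (Inr x)) \<in> hom H P"
    by (auto simp: hom_def letter_mult)
  have "subgroup (factor True) P" "subgroup (factor False) P"
    unfolding T F
    by (rule group_hom.img_is_subgroup; unfold_locales; rule homs)+
  then show ?thesis by (cases s) auto
qed

text \<open>Let \<open>G\<close> act on itself by right multiplication and \<open>H\<close> act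
  trivially: the orbit of the unit recovers \<open>x\<close> from its letter. Faithfulness of the
  two factors is what later excludes cycles shorter than \<open>p\<close> and
  \<open>q\<close>.\<close>

lemma inj_letter_Inl: "inj_on (\<lambda>x. letter (Inl x)) (carrier G)"
proof (rule inj_onI)
  define t where "t g = case_sum (\<lambda>x. g \<otimes>\<^bsub>G\<^esub> x) (\<lambda>_ :: 'b. g)" for g
  have t: "acts_on (carrier G) t"
    by (rule acts_onI) (auto simp: t_def G.m_assoc split: sum.split)
  have "act t \<one>\<^bsub>G\<^esub> (letter (Inl x)) = x" if "x \<in> carrier G" for x
    using act_letter[OF t, of "\<one>\<^bsub>G\<^esub>" "Inl x"] that by (simp add: letter_def t_def)
  then show "x = y" if "x \<in> carrier G" "y \<in> carrier G" "letter (Inl x) = letter (Inl y)" for x y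
    using that by metis
qed

lemma inj_letter_Inr: "inj_on (\<lambda>x. letter (Inr x)) (carrier H)"
proof (rule inj_onI)
  define t where "t g = case_sum (\<lambda>_ :: 'a. g) (\<lambda>x. g \<otimes>\<^bsub>H\<^esub> x)" for g
  have t: "acts_on (carrier H) t"
    by (rule acts_onI) (auto simp: t_def H.m_assoc split: sum.split)
  have "act t \<one>\<^bsub>H\<^esub> (letter (Inr x)) = x" if "x \<in> carrier H" for x
    using act_letter[OF t, of "\<one>\<^bsub>H\<^esub>" "Inr x"] that by (simp add: letter_def t_def)
  then show "x = y" if "x \<in> carrier H" "y \<in> carrier H" "letter (Inr x) = letter (Inr y)" for x y
    using that by metis
qed

lemma P_induct [consumes 1, case_names one snoc]:
  assumes "g \<in> carrier P" "\<Phi> \<one>\<^bsub>P\<^esub>"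
    and "\<And>g a. g \<in> carrier P \<Longrightarrow> a \<in> letters \<Longrightarrow> \<Phi> g \<Longrightarrow> \<Phi> (g \<otimes>\<^bsub>P\<^esub> letter a)"
  shows "\<Phi> g"
  using assms unfolding P_def letter_def by (rule carrier_induct)

lemma regular_action:
  "acts_on (carrier P) (\<lambda>g a. g \<otimes>\<^bsub>P\<^esub> letter a)"
  "g \<in> carrier P \<Longrightarrow> h \<in> carrier P \<Longrightarrow> act (\<lambda>g a. g \<otimes>\<^bsub>P\<^esub> letter a) g h = g \<otimes>\<^bsub>P\<^esub> h"
  unfolding letter_def
  by (rule acts_on_of_action act_of_action; simp add: P.m_assoc flip: P_def)+

end

locale finite_index_subgroup = free_product_of_groups G H
  for G :: "('a, 'c) monoid_scheme" and H :: "('b, 'd) monoid_scheme" +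
  fixes K :: "('a + 'b) list set set"
  assumes K: "subgroup K P"
    and finite_index: "finite (rcosets\<^bsub>P\<^esub> K)"
begin

abbreviation X where "X \<equiv> rcosets\<^bsub>P\<^esub> K"

lemma K_subset: "K \<subseteq> carrier P"
  using K by (rule subgroup.subset)

lemma coset_cases:
  assumes "x \<in> X"
  obtains g where "g \<in> carrier P" "x = K #>\<^bsub>P\<^esub> g"
  using assms by (auto simp: RCOSETS_def)

lemma coset_subset: "x \<in> X \<Longrightarrow> x \<subseteq> carrier P"
  using P.rcosets_subset_PowG[OF K] by blast

lemma coset_closed: "x \<in> X \<Longrightarrow> g \<in> carrier P \<Longrightarrow> x #>\<^bsub>P\<^esub> g \<in> X"
  by (erule coset_cases) (simp add: P.coset_mult_assoc K_subset P.rcosetsI)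

lemma coset_one: "x \<in> X \<Longrightarrow> x #>\<^bsub>P\<^esub> \<one>\<^bsub>P\<^esub> = x"
  using coset_subset by simp

lemma coset_mult:
  "x \<in> X \<Longrightarrow> g \<in> carrier P \<Longrightarrow> h \<in> carrier P \<Longrightarrow> x #>\<^bsub>P\<^esub> (g \<otimes>\<^bsub>P\<^esub> h) = (x #>\<^bsub>P\<^esub> g) #>\<^bsub>P\<^esub> h"
  using coset_subset by (simp add: P.coset_mult_assoc)

lemma K_coset: "K \<in> X"
  using subgroup.subgroup_in_rcosets[OF K P.is_group] .

lemma coset_eq_K_iff: "g \<in> carrier P \<Longrightarrow> K #>\<^bsub>P\<^esub> g = K \<longleftrightarrow> g \<in> K"
  using P.coset_join1 P.coset_join2 K by blast

lemma coset_action: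
  "acts_on X (\<lambda>x a. x #>\<^bsub>P\<^esub> letter a)"
  "x \<in> X \<Longrightarrow> g \<in> carrier P \<Longrightarrow> act (\<lambda>x a. x #>\<^bsub>P\<^esub> letter a) x g = x #>\<^bsub>P\<^esub> g"
  unfolding letter_def
  by (rule acts_on_of_action act_of_action; simp add: coset_one coset_mult coset_closed flip: P_def)+

text \<open>Connectedness of the graph of orbits, in the form that shows that a maximal tree spans
  it.\<close>

lemma transitive:
  assumes "V \<subseteq> X" "K \<in> V" "\<And>x a. x \<in> V \<Longrightarrow> a \<in> letters \<Longrightarrow> x #>\<^bsub>P\<^esub> letter a \<in> V"
  shows "V = X"
proof (rule antisym)
  have "K #>\<^bsub>P\<^esub> g \<in> V" if "g \<in> carrier P" for g
    using that
  proof (induction rule: P_induct)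
    case one
    then show ?case using assms(2) coset_one[OF K_coset] by simp
  next
    case (snoc g a)
    then show ?case using assms(3) coset_mult[OF K_coset] by simp
  qed
  then show "X \<subseteq> V" by (auto elim: coset_cases)
qed fact

text \<open>The cosets are the edges of a bipartite graph: \<open>x\<close> joins its orbit under \<open>factor True\<close>
  to its orbit under \<open>factor False\<close>. A weight \<open>w s x\<close> is assigned to the half of the edge \<open>x\<close> next to
  its orbit under \<open>factor s\<close>, and \<open>P\<close> moves along paths in this graph, collecting weights.\<close>

definition weighted_step ::
    "('m, 'z) monoid_scheme \<Rightarrow> (bool \<Rightarrow> ('a + 'b) list set set \<Rightarrow> 'm) \<Rightarrow>
      ('a + 'b) list set set \<times> 'm \<Rightarrow> 'a + 'b \<Rightarrow> ('a + 'b) list set set \<times> 'm" where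
  "weighted_step M w = (\<lambda>(x, f) a. (x #>\<^bsub>P\<^esub> letter a,
    f \<otimes>\<^bsub>M\<^esub> inv\<^bsub>M\<^esub> (w (isl a) x) \<otimes>\<^bsub>M\<^esub> w (isl a) (x #>\<^bsub>P\<^esub> letter a)))"

section \<open>Actions along weighted paths\<close>

context
  fixes M :: "('m, 'z) monoid_scheme" and w :: "bool \<Rightarrow> ('a + 'b) list set set \<Rightarrow> 'm"
  assumes M: "group M" and weights: "\<forall>s. \<forall>x\<in>X. w s x \<in> carrier M"
begin

private lemma w: "x \<in> X \<Longrightarrow> w s x \<in> carrier M"
  using weights by blast

interpretation M: group M by (fact M)

lemma weighted_action: "acts_on (X \<times> carrier M) (weighted_step M w)"
proof (rule acts_onI)
  have tele: "f \<otimes>\<^bsub>M\<^esub> inv\<^bsub>M\<^esub> a \<otimes>\<^bsub>M\<^esub> b \<otimes>\<^bsub>M\<^esub> inv\<^bsub>M\<^esub> b \<otimes>\<^bsub>M\<^esub> c = f \<otimes>\<^bsub>M\<^esub> inv\<^bsub>M\<^esub> a \<otimes>\<^bsub>M\<^esub> c"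
    if "f \<in> carrier M" "a \<in> carrier M" "b \<in> carrier M" "c \<in> carrier M" for f a b c
    using that by (metis M.inv_closed M.inv_solve_right' M.m_closed)
  \<comment> \<open>Letters of the same factor use the same weight function, so \<open>tele\<close>
    cancels the weight at the intermediate coset. Both factors are covered at once.\<close>
  have pair: "x \<in> X \<Longrightarrow> f \<in> carrier M \<Longrightarrow> a \<in> letters \<Longrightarrow> b \<in> letters \<Longrightarrow> c \<in> letters \<Longrightarrow>
    isl a = isl b \<Longrightarrow> isl c = isl b \<Longrightarrow> letter a \<otimes>\<^bsub>P\<^esub> letter b = letter c \<Longrightarrow>
    weighted_step M w (weighted_step M w (x, f) a) b = weighted_step M w (x, f) c" for x f a b c
    using coset_mult[of x "letter a" "letter b"]
    by (simp add: weighted_step_def tele w coset_closed)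
  show "weighted_step M w (weighted_step M w s (Inl x)) (Inl y) = weighted_step M w s (Inl (x \<otimes>\<^bsub>G\<^esub> y))"
    if "s \<in> X \<times> carrier M" "x \<in> carrier G" "y \<in> carrier G" for s x y
    using that by (cases s) (auto intro!: pair simp: letter_mult)
  show "weighted_step M w (weighted_step M w s (Inr x)) (Inr y) = weighted_step M w s (Inr (x \<otimes>\<^bsub>H\<^esub> y))"
    if "s \<in> X \<times> carrier M" "x \<in> carrier H" "y \<in> carrier H" for s x y
    using that by (cases s) (auto intro!: pair simp: letter_mult)
qed (auto simp: weighted_step_def w coset_closed letter_one coset_one M.m_assoc)

lemma weighted_fst:
  "x \<in> X \<Longrightarrow> f \<in> carrier M \<Longrightarrow> g \<in> carrier P \<Longrightarrow>
    fst (act (weighted_step M w) (x, f) g) = x #>\<^bsub>P\<^esub> g"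
  using act_morphism'[OF weighted_action coset_action(1), where f = fst and s = "(x, f)" and g = g]
    coset_action(2)[of x g]
  by (auto simp: weighted_step_def)

lemma weighted_closed:
  "x \<in> X \<Longrightarrow> f \<in> carrier M \<Longrightarrow> g \<in> carrier P \<Longrightarrow>
    snd (act (weighted_step M w) (x, f) g) \<in> carrier M"
  using act_closed'[OF weighted_action, of "(x, f)" g] by (auto simp: mem_Times_iff)

lemma weighted_mult:
  "x \<in> X \<Longrightarrow> f \<in> carrier M \<Longrightarrow> g \<in> carrier P \<Longrightarrow> h \<in> carrier P \<Longrightarrow>
    act (weighted_step M w) (x, f) (g \<otimes>\<^bsub>P\<^esub> h) =
    act (weighted_step M w) (act (weighted_step M w) (x, f) g) h"
  using act_mult'[OF weighted_action, of "(x, f)" g h] by auto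

text \<open>Weights are collected on the right, so a factor on the left is inert. This makes the
  weight of a closed path multiplicative in the path, and allows a return path to be reused with
  another starting weight.\<close>

lemma weighted_left:
  assumes "x \<in> X" "f \<in> carrier M" "m \<in> carrier M" "g \<in> carrier P"
    "act (weighted_step M w) (x, f) g = (y, f')"
  shows "act (weighted_step M w) (x, m \<otimes>\<^bsub>M\<^esub> f) g = (y, m \<otimes>\<^bsub>M\<^esub> f')"
proof -
  have "apsnd (\<lambda>f. m \<otimes>\<^bsub>M\<^esub> f) (act (weighted_step M w) (x, f) g) =
      act (weighted_step M w) (apsnd (\<lambda>f. m \<otimes>\<^bsub>M\<^esub> f) (x, f)) g"
    by (rule act_morphism'[OF weighted_action weighted_action])
      (use assms in \<open>auto simp: weighted_step_def w coset_closed M.m_assoc\<close>)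
  then show ?thesis using assms(5) by simp
qed

lemma weighted_factor:
  assumes "x \<in> X" "f \<in> carrier M" "g \<in> factor s"
  shows "act (weighted_step M w) (x, f) g =
    (x #>\<^bsub>P\<^esub> g, f \<otimes>\<^bsub>M\<^esub> inv\<^bsub>M\<^esub> (w s x) \<otimes>\<^bsub>M\<^esub> w s (x #>\<^bsub>P\<^esub> g))"
  using assms act_letter[OF weighted_action, of "(x, f)"]
  by (auto simp: factor_def letter_def weighted_step_def)

end

end

section \<open>Subgroups acting semiregularly\<close>

text \<open>The condition speaks of single letters, but every element of a factor is one letter, so
  both factors act freely on the cosets.\<close>

locale semiregular_subgroup = finite_index_subgroup G H K
  for G :: "('a, 'c) monoid_scheme" and H :: "('b, 'd) monoid_scheme" and K +
  assumes semiregular: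
    "\<And>x a. x \<in> X \<Longrightarrow> a \<in> letters \<Longrightarrow> x #>\<^bsub>P\<^esub> letter a = x \<Longrightarrow> letter a = \<one>\<^bsub>P\<^esub>"
begin

text \<open>Two elements with the same effect differ by an element of the factor fixing
  \<open>x\<close>. Each orbit is thus a copy of the factor, and a path to one of its edges
  determines paths to all of them.\<close>

lemma inj_on_factor:
  assumes "x \<in> X"
  shows "inj_on (\<lambda>g. x #>\<^bsub>P\<^esub> g) (factor s)"
proof (rule inj_onI)
  fix g h assume gh: "g \<in> factor s" "h \<in> factor s" and eq: "x #>\<^bsub>P\<^esub> g = x #>\<^bsub>P\<^esub> h"
  have c: "g \<in> carrier P" "h \<in> carrier P" using gh factor_closed by auto
  have "g \<otimes>\<^bsub>P\<^esub> inv\<^bsub>P\<^esub> h \<in> factor s"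
    using gh subgroup_factor[of s] by (simp add: subgroup.m_closed subgroup.m_inv_closed)
  moreover have "x #>\<^bsub>P\<^esub> (g \<otimes>\<^bsub>P\<^esub> inv\<^bsub>P\<^esub> h) = x"
    using c assms eq coset_mult[of x g "inv\<^bsub>P\<^esub> h"] coset_mult[of x h "inv\<^bsub>P\<^esub> h"] coset_one by simp
  ultimately have "g \<otimes>\<^bsub>P\<^esub> inv\<^bsub>P\<^esub> h = \<one>\<^bsub>P\<^esub>"
    using semiregular[OF assms] by (auto simp: factor_def)
  then show "g = h" using c by (metis P.inv_equality P.inv_inv P.inv_closed)
qed

text \<open>A subtree, containing the base vertex, of the graph of orbits: \<open>U s\<close> consists of the
  edges at its vertices of type \<open>s\<close>, and \<open>c s x\<close> is the element of \<open>P\<close> that leads from the base point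
  along the tree to the end of type \<open>s\<close> of the edge \<open>x\<close>. The tree edges are those \<open>x\<close> with
  \<open>c True x = c False x\<close>. That these form a tree is expressed by the last condition: a weight that
  vanishes on them is trivial along the chosen paths, except on the last half-edge.\<close>

definition schreier_tree ::
    "(bool \<Rightarrow> ('a + 'b) list set set set) \<Rightarrow> (bool \<Rightarrow> ('a + 'b) list set set \<Rightarrow> ('a + 'b) list set) \<Rightarrow> bool"
  where
  "schreier_tree U c \<longleftrightarrow>
    (\<forall>s. U s \<subseteq> X) \<and> K \<in> U False \<and> c False K = \<one>\<^bsub>P\<^esub> \<and>
    (\<forall>s. \<forall>x\<in>U s. c s x \<in> carrier P \<and> K #>\<^bsub>P\<^esub> c s x = x) \<and>
    (\<forall>s. \<forall>x\<in>U s. \<forall>g\<in>factor s. x #>\<^bsub>P\<^esub> g \<in> U s \<and> c s (x #>\<^bsub>P\<^esub> g) = c s x \<otimes>\<^bsub>P\<^esub> g) \<and>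
    (\<forall>(M :: (('a + 'b) list set \<times> bool) list set monoid) w.
      group M \<longrightarrow> (\<forall>s. \<forall>x\<in>X. w s x \<in> carrier M) \<longrightarrow> w False K = \<one>\<^bsub>M\<^esub> \<longrightarrow>
      (\<forall>x\<in>U True \<inter> U False. c True x = c False x \<longrightarrow> w True x = w False x) \<longrightarrow>
      (\<forall>s. \<forall>x\<in>U s. act (weighted_step M w) (K, \<one>\<^bsub>M\<^esub>) (c s x) = (x, w s x)))"

section \<open>Growth of a spanning tree\<close>

lemma schreier_treeD:
  assumes "schreier_tree U c"
  shows "U s \<subseteq> X" "K \<in> U False" "c False K = \<one>\<^bsub>P\<^esub>"
    and "x \<in> U s \<Longrightarrow> c s x \<in> carrier P" "x \<in> U s \<Longrightarrow> K #>\<^bsub>P\<^esub> c s x = x"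
    and "x \<in> U s \<Longrightarrow> g \<in> factor s \<Longrightarrow> x #>\<^bsub>P\<^esub> g \<in> U s"
    and "x \<in> U s \<Longrightarrow> g \<in> factor s \<Longrightarrow> c s (x #>\<^bsub>P\<^esub> g) = c s x \<otimes>\<^bsub>P\<^esub> g"
  using assms unfolding schreier_tree_def by simp_all

text \<open>The type of \<open>M\<close> is fixed because a definition cannot quantify over types;
  it is the type of a free group on a set of elements of \<open>P\<close>, the group in which the
  weights are taken in the end.\<close>

lemma schreier_tree_act:
  fixes M :: "(('a + 'b) list set \<times> bool) list set monoid"
  assumes "schreier_tree U c" "group M" "\<forall>s. \<forall>x\<in>X. w s x \<in> carrier M" "w False K = \<one>\<^bsub>M\<^esub>"
    and "\<And>x. x \<in> U True \<Longrightarrow> x \<in> U False \<Longrightarrow> c True x = c False x \<Longrightarrow> w True x = w False x"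
    and "x \<in> U s"
  shows "act (weighted_step M w) (K, \<one>\<^bsub>M\<^esub>) (c s x) = (x, w s x)"
  by (rule assms(1)[unfolded schreier_tree_def, THEN conjunct2, THEN conjunct2, THEN conjunct2,
      THEN conjunct2, THEN conjunct2, rule_format]) (use assms(2-) in auto)

text \<open>The tree whose single vertex is the orbit of \<open>K\<close> under
  \<open>factor False\<close>. No edge has both ends in it, and since \<open>w\<close> is trivial at
  the root, the weight collected within the orbit is that of the last half-edge.\<close>

lemma schreier_tree_root:
  "schreier_tree (\<lambda>s. if s then {} else (\<lambda>g. K #>\<^bsub>P\<^esub> g) ` factor False)
    (\<lambda>s. inv_into (factor False) (\<lambda>g. K #>\<^bsub>P\<^esub> g))" (is "schreier_tree ?U ?c")
proof -
  have c: "?c s (K #>\<^bsub>P\<^esub> g) = g" if "g \<in> factor False" for s g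
    using inj_on_factor[OF K_coset] that by (simp add: inv_into_f_f)
  have one: "\<one>\<^bsub>P\<^esub> \<in> factor s" for s
    using subgroup.one_closed[OF subgroup_factor] .
  have K1: "K = K #>\<^bsub>P\<^esub> \<one>\<^bsub>P\<^esub>"
    using coset_one[OF K_coset] by simp
  show ?thesis
    unfolding schreier_tree_def
  proof (intro conjI allI impI ballI)
    show "K \<in> ?U False" using one K1 by auto
    show "?c False K = \<one>\<^bsub>P\<^esub>" using c[OF one] K1 by simp
  next
    fix s x g assume "x \<in> ?U s" and g: "g \<in> factor s"
    then obtain h where h: "s = False" "h \<in> factor False" "x = K #>\<^bsub>P\<^esub> h" by (auto split: if_splits)
    then have "x #>\<^bsub>P\<^esub> g = K #>\<^bsub>P\<^esub> (h \<otimes>\<^bsub>P\<^esub> g)" "h \<otimes>\<^bsub>P\<^esub> g \<in> factor False"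
      using coset_mult[OF K_coset] g factor_closed subgroup.m_closed[OF subgroup_factor] by auto
    then show "x #>\<^bsub>P\<^esub> g \<in> ?U s" "?c s (x #>\<^bsub>P\<^esub> g) = ?c s x \<otimes>\<^bsub>P\<^esub> g"
      using h c by auto
  next
    fix M :: "(('a + 'b) list set \<times> bool) list set monoid" and w s x
    assume M: "group M" and w: "\<forall>s. \<forall>x\<in>X. w s x \<in> carrier M" "w False K = \<one>\<^bsub>M\<^esub>" and "x \<in> ?U s"
    then obtain h where h: "s = False" "h \<in> factor False" "x = K #>\<^bsub>P\<^esub> h" by (auto split: if_splits)
    interpret M: group M by fact
    have "w False x \<in> carrier M" using w h coset_closed[OF K_coset] factor_closed by auto
    then show "act (weighted_step M w) (K, \<one>\<^bsub>M\<^esub>) (?c s x) = (x, w s x)"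
      using weighted_factor[OF M w(1) K_coset, of "\<one>\<^bsub>M\<^esub>" h False] h w c K_coset by simp
  qed (use c factor_closed coset_closed[OF K_coset] in \<open>auto split: if_splits\<close>)
qed

text \<open>The edge \<open>y\<close> has exactly one end in the tree. Its other end is attached as
  a new vertex, whose edges are reached by following the path to \<open>y\<close> and turning there
  by an element of \<open>factor (\<not> r)\<close>.\<close>

lemma schreier_tree_extend:
  assumes tree: "schreier_tree U c" and y: "y \<in> U r" "y \<notin> U (\<not> r)"
  defines "d \<equiv> \<lambda>x. c r y \<otimes>\<^bsub>P\<^esub> inv_into (factor (\<not> r)) (\<lambda>g. y #>\<^bsub>P\<^esub> g) x"
  shows "schreier_tree (U(\<not> r := U (\<not> r) \<union> (\<lambda>g. y #>\<^bsub>P\<^esub> g) ` factor (\<not> r)))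
    (c(\<not> r := \<lambda>x. if x \<in> U (\<not> r) then c (\<not> r) x else d x))"
    (is "schreier_tree ?U ?c")
proof -
  note t = schreier_treeD[OF tree]
  have yX: "y \<in> X" using t(1) y(1) by blast
  have cy: "c r y \<in> carrier P" "K #>\<^bsub>P\<^esub> c r y = y" using t(4,5)[OF y(1)] by auto
  have one: "\<one>\<^bsub>P\<^esub> \<in> factor s" for s
    using subgroup.one_closed[OF subgroup_factor] .
  have d: "d (y #>\<^bsub>P\<^esub> g) = c r y \<otimes>\<^bsub>P\<^esub> g" if "g \<in> factor (\<not> r)" for g
    using inj_on_factor[OF yX] that by (simp add: d_def inv_into_f_f)
  \<comment> \<open>This makes \<open>y\<close> a tree edge: the paths chosen for its two ends
    coincide.\<close>
  have dy: "d y = c r y" using d[OF one] cy coset_one[OF yX] by simp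
  \<comment> \<open>\<open>U (\<not> r)\<close> is a union of orbits, so a common element would put
    \<open>y\<close> itself into it.\<close>
  have new: "y #>\<^bsub>P\<^esub> g \<notin> U (\<not> r)" if g: "g \<in> factor (\<not> r)" for g
  proof
    assume "y #>\<^bsub>P\<^esub> g \<in> U (\<not> r)"
    moreover have "inv\<^bsub>P\<^esub> g \<in> factor (\<not> r)"
      using subgroup.m_inv_closed[OF subgroup_factor] g by blast
    ultimately have "y #>\<^bsub>P\<^esub> g #>\<^bsub>P\<^esub> inv\<^bsub>P\<^esub> g \<in> U (\<not> r)" by (rule t(6))
    then show False
      using y coset_mult[OF yX, of g "inv\<^bsub>P\<^esub> g"] factor_closed[OF g] coset_one[OF yX] by simp
  qed
  have old: "?c s x = c s x" if "x \<in> U s" for s x using that by auto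
  have cases: thesis if "x \<in> ?U s" "x \<in> U s \<Longrightarrow> thesis"
    "\<And>g. s = (\<not> r) \<Longrightarrow> g \<in> factor (\<not> r) \<Longrightarrow> x = y #>\<^bsub>P\<^esub> g \<Longrightarrow> ?c s x = c r y \<otimes>\<^bsub>P\<^esub> g \<Longrightarrow> thesis"
    for s x thesis
    using that d new by (auto split: if_splits)
  show ?thesis
    unfolding schreier_tree_def
  proof (intro conjI allI impI ballI)
    show "?U s \<subseteq> X" for s using t(1) coset_closed[OF yX] factor_closed by auto
    show "K \<in> ?U False" using t(2) by auto
    show "?c False K = \<one>\<^bsub>P\<^esub>" using t(3) old[OF t(2)] by simp
  next
    fix s x assume "x \<in> ?U s"
    then have "?c s x \<in> carrier P \<and> K #>\<^bsub>P\<^esub> ?c s x = x"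
    proof (rule cases)
      assume x: "x \<in> U s"
      show ?thesis unfolding old[OF x] using t(4,5)[OF x] by simp
    next
      fix g assume "s = (\<not> r)" "g \<in> factor (\<not> r)" "x = y #>\<^bsub>P\<^esub> g" "?c s x = c r y \<otimes>\<^bsub>P\<^esub> g"
      then show ?thesis
        using cy factor_closed coset_mult[OF K_coset, of "c r y" g] by simp
    qed
    then show "?c s x \<in> carrier P" "K #>\<^bsub>P\<^esub> ?c s x = x" by auto
  next
    fix s x g assume "x \<in> ?U s" and g: "g \<in> factor s"
    then have "x #>\<^bsub>P\<^esub> g \<in> ?U s \<and> ?c s (x #>\<^bsub>P\<^esub> g) = ?c s x \<otimes>\<^bsub>P\<^esub> g"
    proof (rule_tac cases)
      assume x: "x \<in> U s"
      have xg: "x #>\<^bsub>P\<^esub> g \<in> U s" and "c s (x #>\<^bsub>P\<^esub> g) = c s x \<otimes>\<^bsub>P\<^esub> g" using t(6,7)[OF x g] by auto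
      then show ?thesis unfolding old[OF x] old[OF xg] using xg by auto
    next
      fix h assume h: "s = (\<not> r)" "h \<in> factor (\<not> r)" "x = y #>\<^bsub>P\<^esub> h" "?c s x = c r y \<otimes>\<^bsub>P\<^esub> h"
      then have hg: "h \<otimes>\<^bsub>P\<^esub> g \<in> factor (\<not> r)"
        using g subgroup.m_closed[OF subgroup_factor] by blast
      have x: "x #>\<^bsub>P\<^esub> g = y #>\<^bsub>P\<^esub> (h \<otimes>\<^bsub>P\<^esub> g)"
        using h g factor_closed coset_mult[OF yX] by simp
      have "?c s (x #>\<^bsub>P\<^esub> g) = c r y \<otimes>\<^bsub>P\<^esub> (h \<otimes>\<^bsub>P\<^esub> g)"
        using new[OF hg] d[OF hg] x h by simp
      moreover have "x #>\<^bsub>P\<^esub> g \<in> ?U s" using x hg h by auto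
      ultimately show ?thesis using h g factor_closed cy by (simp add: P.m_assoc)
    qed
    then show "x #>\<^bsub>P\<^esub> g \<in> ?U s" "?c s (x #>\<^bsub>P\<^esub> g) = ?c s x \<otimes>\<^bsub>P\<^esub> g" by auto
  next
    fix M :: "(('a + 'b) list set \<times> bool) list set monoid" and w s x
    assume M: "group M" and w: "\<forall>s. \<forall>x\<in>X. w s x \<in> carrier M" and wK: "w False K = \<one>\<^bsub>M\<^esub>"
      and vanish: "\<forall>x\<in>?U True \<inter> ?U False. ?c True x = ?c False x \<longrightarrow> w True x = w False x"
      and "x \<in> ?U s"
    interpret M: group M by fact
    have "w True x = w False x" if "x \<in> U True \<inter> U False" "c True x = c False x" for x
      using vanish[rule_format, of x] that unfolding old[OF IntD1[OF that(1)]] old[OF IntD2[OF that(1)]] by auto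
    then have IH: "act (weighted_step M w) (K, \<one>\<^bsub>M\<^esub>) (c s x) = (x, w s x)" if "x \<in> U s" for s x
      using wK that by (intro schreier_tree_act[OF tree M w]) auto
    have "y #>\<^bsub>P\<^esub> \<one>\<^bsub>P\<^esub> = y" using coset_one[OF yX] .
    then have "y \<in> ?U True \<inter> ?U False"
      using y one by (cases r) (auto intro: rev_image_eqI)
    moreover have "?c True y = ?c False y" using y dy by (cases r) auto
    \<comment> \<open>The condition at the new tree edge lets the path cross \<open>y\<close>
      without a change of weight.\<close>
    ultimately have wy: "w r y = w (\<not> r) y" using vanish by (cases r) auto
    show "act (weighted_step M w) (K, \<one>\<^bsub>M\<^esub>) (?c s x) = (x, w s x)"
      using \<open>x \<in> ?U s\<close>
    proof (rule cases)
      assume x: "x \<in> U s"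
      show ?thesis unfolding old[OF x] by (rule IH[OF x])
    next
      fix g assume g: "s = (\<not> r)" "g \<in> factor (\<not> r)" "x = y #>\<^bsub>P\<^esub> g" and c: "?c s x = c r y \<otimes>\<^bsub>P\<^esub> g"
      have wM: "w s x \<in> carrier M" for s
        using w g coset_closed[OF yX] factor_closed by auto
      have "act (weighted_step M w) (K, \<one>\<^bsub>M\<^esub>) (c r y \<otimes>\<^bsub>P\<^esub> g) = act (weighted_step M w) (y, w r y) g"
        using weighted_mult[OF M w K_coset, of "\<one>\<^bsub>M\<^esub>" "c r y" g] w K_coset cy g factor_closed IH[OF y(1)]
        by simp
      also have "\<dots> = (x, w s x)"
        using weighted_factor[OF M w yX, of "w r y" g s] w yX wy g wM by simp
      finally show ?thesis unfolding c .
    qed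
  qed
qed

text \<open>Since \<open>X\<close> is finite, some tree has the largest number of half-edges. By
  maximality no edge has just one end in it, so its edges are closed under both factors and are all
  of \<open>X\<close>.\<close>

lemma schreier_tree_spanning:
  obtains c where "schreier_tree (\<lambda>_. X) c"
proof -
  let ?f = "\<lambda>(U, c). card (U True) + card (U False)"
  have bound: "?f (U, c) < Suc (2 * card X)" if "schreier_tree U c" for U c
  proof -
    have "U s \<subseteq> X" for s using schreier_treeD(1)[OF that] .
    then have "card (U s) \<le> card X" for s using finite_index card_mono by blast
    then show ?thesis using add_mono[of "card (U True)" "card X" "card (U False)" "card X"] by simp
  qed
  define tree_pair where "tree_pair = (\<lambda>(U, c). schreier_tree U c)"
  have root: "tree_pair (\<lambda>s. if s then {} else (\<lambda>g. K #>\<^bsub>P\<^esub> g) ` factor False,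
      \<lambda>s. inv_into (factor False) (\<lambda>g. K #>\<^bsub>P\<^esub> g))"
    using schreier_tree_root by (simp add: tree_pair_def)
  have bound': "\<forall>Z. tree_pair Z \<longrightarrow> ?f Z < Suc (2 * card X)"
    using bound by (simp add: tree_pair_def split_paired_all)
  obtain Z where Z: "tree_pair Z" "\<And>Z'. tree_pair Z' \<Longrightarrow> ?f Z' \<le> ?f Z"
    using ex_has_greatest_nat[of tree_pair _ ?f "Suc (2 * card X)", OF root] bound'
    by blast
  obtain U c where "Z = (U, c)" by fastforce
  then have tree: "schreier_tree U c"
    and max: "\<And>U' c'. schreier_tree U' c' \<Longrightarrow> ?f (U', c') \<le> ?f (U, c)"
    using Z by (auto simp: tree_pair_def)
  have UX: "U s \<subseteq> X" for s using schreier_treeD(1)[OF tree] .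
  have swap: "y \<in> U (\<not> r)" if y: "y \<in> U r" for y r
  proof (rule ccontr)
    assume n: "y \<notin> U (\<not> r)"
    let ?V = "U (\<not> r) \<union> (\<lambda>g. y #>\<^bsub>P\<^esub> g) ` factor (\<not> r)"
    have tr: "schreier_tree (U(\<not> r := ?V)) (c(\<not> r := \<lambda>x. if x \<in> U (\<not> r) then c (\<not> r) x
        else c r y \<otimes>\<^bsub>P\<^esub> inv_into (factor (\<not> r)) (\<lambda>g. y #>\<^bsub>P\<^esub> g) x))"
      by (rule schreier_tree_extend[OF tree y n])
    from schreier_treeD(1)[OF tr, of "\<not> r"] have "?V \<subseteq> X" by simp
    then have "finite ?V" using finite_index finite_subset by blast
    moreover have "y \<in> ?V"
      using subgroup.one_closed[OF subgroup_factor] coset_one y UX by (metis UnI2 image_eqI subsetD)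
    ultimately have "card (U (\<not> r)) < card ?V" using n by (intro psubset_card_mono) auto
    then show False using max[OF tr] by (cases r) auto
  qed
  have eq: "U True = U False" using swap[of _ True] swap[of _ False] by auto
  have "U False = X"
  proof (rule transitive)
    show "x #>\<^bsub>P\<^esub> letter a \<in> U False" if "x \<in> U False" "a \<in> letters" for x a
    proof -
      have "letter a \<in> factor (isl a)" using that by (auto simp: factor_def)
      moreover have "x \<in> U (isl a)" using that eq by (cases "isl a") auto
      ultimately have "x #>\<^bsub>P\<^esub> letter a \<in> U (isl a)" using schreier_treeD(6)[OF tree] by blast
      then show ?thesis using eq by (cases "isl a") auto
    qed
  qed (use schreier_treeD(1,2)[OF tree] in auto)
  then have "U = (\<lambda>_. X)" using eq by (metis (full_types) ext)
  then show thesis using that tree by blast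
qed

text \<open>A special case of the Kurosh subgroup theorem: \<open>K\<close> is the fundamental group of the graph of
  orbits, and so is free on the edges outside a spanning tree.\<close>

theorem is_free_group_K: "is_free_group (P\<lparr>carrier := K\<rparr>)"
proof -
  obtain c where tree: "schreier_tree (\<lambda>_. X) c" by (rule schreier_tree_spanning)
  note t = schreier_treeD[OF tree]
  have cP: "c s x \<in> carrier P" "K #>\<^bsub>P\<^esub> c s x = x" if "x \<in> X" for s x using t(4,5) that by auto
  have cK: "c False K = \<one>\<^bsub>P\<^esub>" using t(3) .
  have c_letter: "c (isl a) (x #>\<^bsub>P\<^esub> letter a) = c (isl a) x \<otimes>\<^bsub>P\<^esub> letter a"
    if "x \<in> X" "a \<in> letters" for x a
    using that by (intro t(7)) (auto simp: factor_def)
  \<comment> \<open>An edge outside the tree is named by its tree path \<open>c False x\<close>,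
    which determines \<open>x\<close>. Being elements of \<open>P\<close>, these names have the type
    that \<open>is_free_group\<close> demands of a basis.\<close>
  define S where "S = c False ` {x \<in> X. c True x \<noteq> c False x}"
  interpret F: free_group_basis S .
  \<comment> \<open>One half-edge suffices to register a crossing. Leaving the \<open>False\<close>
    halves trivial gives the normalisation at the root required by
    \<open>schreier_tree_act\<close>.\<close>
  define w where "w s x = (if s \<and> c True x \<noteq> c False x then F.gen (c False x) else \<one>\<^bsub>F.F\<^esub>)" for s x
  have w: "w s x \<in> carrier F.F" if "x \<in> X" for s x
  proof -
    have "c False x \<in> S" if "c True x \<noteq> c False x" using that \<open>x \<in> X\<close> by (simp add: S_def)
    then show ?thesis by (auto simp: w_def)
  qed
  then have weights: "\<forall>s. \<forall>x\<in>X. w s x \<in> carrier F.F" by blast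
  have wF: "w False x = \<one>\<^bsub>F.F\<^esub>" for x by (simp add: w_def)
  have path: "act (weighted_step F.F w) (K, \<one>\<^bsub>F.F\<^esub>) (c s x) = (x, w s x)" if "x \<in> X" for s x
    using that by (intro schreier_tree_act[OF tree F.F.is_group weights]) (auto simp: w_def)
  \<comment> \<open>Here \<sigma> is the path to the \<open>False\<close> end of an edge, and the
    edge is recovered as the coset of \<sigma>. Both paths lead from \<open>K\<close> to that edge,
    so the product is a closed path.\<close>
  define e where "e \<sigma> = c True (K #>\<^bsub>P\<^esub> \<sigma>) \<otimes>\<^bsub>P\<^esub> inv\<^bsub>P\<^esub> \<sigma>" for \<sigma>
  have S_cases: thesis if "\<sigma> \<in> S" "\<And>x. x \<in> X \<Longrightarrow> c True x \<noteq> c False x \<Longrightarrow> \<sigma> = c False x \<Longrightarrow>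
    \<sigma> \<in> carrier P \<Longrightarrow> K #>\<^bsub>P\<^esub> \<sigma> = x \<Longrightarrow> thesis" for \<sigma> thesis
    using that cP by (auto simp: S_def)
  have e: "e \<sigma> \<in> carrier P" if "\<sigma> \<in> S" for \<sigma>
    using that by (rule S_cases) (use cP in \<open>simp add: e_def\<close>)
  obtain \<eta> where \<eta>: "\<eta> \<in> hom F.F P" "\<And>\<sigma>. \<sigma> \<in> S \<Longrightarrow> \<eta> (F.gen \<sigma>) = e \<sigma>"
    using F.lift_hom[of P e] e P.is_group by metis
  interpret \<eta>: group_hom F.F P \<eta>
    by unfold_locales fact
  \<comment> \<open>The image of a weight under \<eta> is the discrepancy between the tree paths to
    the two ends of \<open>x\<close>; on a tree edge there is none.\<close>
  have \<eta>w: "\<eta> (w s x) \<otimes>\<^bsub>P\<^esub> c False x = c s x" if "x \<in> X" for s x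
  proof (cases "s \<and> c True x \<noteq> c False x")
    case True
    then have "c False x \<in> S" using that by (auto simp: S_def)
    then show ?thesis using True cP[OF that] \<eta>(2) by (simp add: w_def e_def P.m_assoc)
  next
    case False
    then show ?thesis using cP[OF that] by (cases s) (auto simp: w_def)
  qed
  \<comment> \<open>A state of the weighted action is sent to the element of \<open>P\<close> that
    it stands for: the loops spelled by \<open>f\<close>, then the tree path to
    \<open>x\<close>.\<close>
  define \<Psi> where "\<Psi> = (\<lambda>(x, f). \<eta> f \<otimes>\<^bsub>P\<^esub> c False x)"
  have \<Psi>: "\<Psi> (act (weighted_step F.F w) s g) = \<Psi> s \<otimes>\<^bsub>P\<^esub> g"
    if s: "s \<in> X \<times> carrier F.F" and g: "g \<in> carrier P" for s g
  proof -
    have "\<Psi> (act (weighted_step F.F w) s g) = act (\<lambda>g a. g \<otimes>\<^bsub>P\<^esub> letter a) (\<Psi> s) g"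
    proof (rule act_morphism'[OF weighted_action[OF F.F.is_group weights] regular_action(1)])
      fix s a assume "s \<in> X \<times> carrier F.F" and a: "a \<in> letters"
      then obtain x f where xf: "s = (x, f)" "x \<in> X" "f \<in> carrier F.F" by auto
      let ?s = "isl a" and ?y = "x #>\<^bsub>P\<^esub> letter a"
      have y: "?y \<in> X" using xf a coset_closed by auto
      have "\<Psi> (weighted_step F.F w s a) = \<eta> f \<otimes>\<^bsub>P\<^esub> inv\<^bsub>P\<^esub> (\<eta> (w ?s x)) \<otimes>\<^bsub>P\<^esub> (\<eta> (w ?s ?y) \<otimes>\<^bsub>P\<^esub> c False ?y)"
        using xf w y cP by (simp add: \<Psi>_def weighted_step_def P.m_assoc)
      also have "\<dots> = \<eta> f \<otimes>\<^bsub>P\<^esub> inv\<^bsub>P\<^esub> (\<eta> (w ?s x)) \<otimes>\<^bsub>P\<^esub> ((\<eta> (w ?s x) \<otimes>\<^bsub>P\<^esub> c False x) \<otimes>\<^bsub>P\<^esub> letter a)"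
        using \<eta>w[OF y] \<eta>w[OF xf(2)] c_letter[OF xf(2) a] by simp
      also have "\<dots> = \<Psi> s \<otimes>\<^bsub>P\<^esub> letter a"
      proof -
        define u where "u = \<eta> (w ?s x)"
        have u: "u \<in> carrier P" using xf w by (simp add: u_def)
        have "inv\<^bsub>P\<^esub> u \<otimes>\<^bsub>P\<^esub> (u \<otimes>\<^bsub>P\<^esub> g) = g" if "g \<in> carrier P" for g
          using u that by (simp flip: P.m_assoc)
        then show ?thesis
          unfolding u_def[symmetric] using u xf cP[of x] a by (simp add: \<Psi>_def P.m_assoc)
      qed
      finally show "\<Psi> (weighted_step F.F w s a) = \<Psi> s \<otimes>\<^bsub>P\<^esub> letter a" .
    qed (use s g w cP F.F.is_group in \<open>auto simp: \<Psi>_def\<close>)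
    also have "\<dots> = \<Psi> s \<otimes>\<^bsub>P\<^esub> g"
      using s g cP by (intro regular_action(2)) (auto simp: \<Psi>_def)
    finally show ?thesis .
  qed
  define \<theta> where "\<theta> k = snd (act (weighted_step F.F w) (K, \<one>\<^bsub>F.F\<^esub>) k)" for k
  note W = F.F.is_group weights
  have act_K: "act (weighted_step F.F w) (K, \<one>\<^bsub>F.F\<^esub>) k = (K, \<theta> k)" if "k \<in> K" for k
    using weighted_fst[OF W K_coset F.F.one_closed, of k] that K_subset coset_eq_K_iff[of k]
    by (auto simp: \<theta>_def prod_eq_iff)
  have \<theta>_closed: "\<theta> k \<in> carrier F.F" if "k \<in> K" for k
    using weighted_closed[OF W K_coset F.F.one_closed, of k] that K_subset by (auto simp: \<theta>_def)
  have \<theta>_mult: "\<theta> (k \<otimes>\<^bsub>P\<^esub> k') = \<theta> k \<otimes>\<^bsub>F.F\<^esub> \<theta> k'" if k: "k \<in> K" "k' \<in> K" for k k'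
  proof -
    have kP: "k \<in> carrier P" "k' \<in> carrier P" using k K_subset by auto
    have "act (weighted_step F.F w) (K, \<theta> k \<otimes>\<^bsub>F.F\<^esub> \<one>\<^bsub>F.F\<^esub>) k' = (K, \<theta> k \<otimes>\<^bsub>F.F\<^esub> \<theta> k')"
      by (rule weighted_left[OF W K_coset F.F.one_closed \<theta>_closed[OF k(1)] kP(2) act_K[OF k(2)]])
    then have "act (weighted_step F.F w) (K, \<one>\<^bsub>F.F\<^esub>) (k \<otimes>\<^bsub>P\<^esub> k') = (K, \<theta> k \<otimes>\<^bsub>F.F\<^esub> \<theta> k')"
      using weighted_mult[OF W K_coset F.F.one_closed kP] act_K[OF k(1)] \<theta>_closed[OF k(1)] by simp
    then show ?thesis by (simp add: \<theta>_def)
  qed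
  interpret KG: group "P\<lparr>carrier := K\<rparr>"
    using K P.is_group by (rule subgroup.subgroup_is_group)
  interpret \<theta>: group_hom "P\<lparr>carrier := K\<rparr>" F.F \<theta>
    by unfold_locales (auto simp: hom_def \<theta>_closed \<theta>_mult)
  \<comment> \<open>At \<open>K\<close> the tree path is trivial, so \<Psi> reduces to \<eta> and
    sends the initial state to the unit; equivariance then returns \<open>k\<close>. Injectivity of
    \<theta> follows.\<close>
  have inv: "\<eta> (\<theta> k) = k" if "k \<in> K" for k
  proof -
    have "\<Psi> (K, \<theta> k) = \<Psi> (K, \<one>\<^bsub>F.F\<^esub>) \<otimes>\<^bsub>P\<^esub> k"
      using \<Psi>[of "(K, \<one>\<^bsub>F.F\<^esub>)" k] act_K[OF that] that K_subset K_coset by auto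
    then show ?thesis
      using that K_subset \<theta>_closed[OF that] by (auto simp: \<Psi>_def cK)
  qed
  have gen: "F.gen \<sigma> \<in> \<theta> ` K" if "\<sigma> \<in> S" for \<sigma>
    using that
  proof (rule S_cases)
    fix x assume x: "x \<in> X" "c True x \<noteq> c False x" "\<sigma> = c False x" "\<sigma> \<in> carrier P" "K #>\<^bsub>P\<^esub> \<sigma> = x"
    note s = K_coset F.F.one_closed
    have "act (weighted_step F.F w) (K, \<one>\<^bsub>F.F\<^esub>) \<sigma> = (x, \<one>\<^bsub>F.F\<^esub>)"
      using path[OF x(1), of False] x by (simp add: wF)
    then have "act (weighted_step F.F w) (x, \<one>\<^bsub>F.F\<^esub>) (inv\<^bsub>P\<^esub> \<sigma>) =
        act (weighted_step F.F w) (K, \<one>\<^bsub>F.F\<^esub>) (\<sigma> \<otimes>\<^bsub>P\<^esub> inv\<^bsub>P\<^esub> \<sigma>)"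
      using weighted_mult[OF W s, of \<sigma> "inv\<^bsub>P\<^esub> \<sigma>"] x by simp
    also have "\<dots> = (K, \<one>\<^bsub>F.F\<^esub>)"
      using act_one'[OF weighted_action[OF W], of "(K, \<one>\<^bsub>F.F\<^esub>)"] K_coset x by simp
    finally have ret: "act (weighted_step F.F w) (x, \<one>\<^bsub>F.F\<^esub>) (inv\<^bsub>P\<^esub> \<sigma>) = (K, \<one>\<^bsub>F.F\<^esub>)" .
    have wx: "w True x = F.gen \<sigma>" using x by (simp add: w_def)
    have "act (weighted_step F.F w) (K, \<one>\<^bsub>F.F\<^esub>) (e \<sigma>) =
        act (weighted_step F.F w) (x, F.gen \<sigma>) (inv\<^bsub>P\<^esub> \<sigma>)"
      using weighted_mult[OF W s, of "c True x" "inv\<^bsub>P\<^esub> \<sigma>"] path[OF x(1), of True] cP[OF x(1)] x wx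
      by (simp add: e_def)
    \<comment> \<open>The way back collects nothing when started with the unit; started with
      \<open>F.gen \<sigma>\<close>, it keeps that value, by left translation.\<close>
    also have "\<dots> = (K, F.gen \<sigma>)"
      using weighted_left[OF W x(1) F.F.one_closed F.gen_closed[OF that] _ ret] x that by simp
    finally have E: "act (weighted_step F.F w) (K, \<one>\<^bsub>F.F\<^esub>) (e \<sigma>) = (K, F.gen \<sigma>)" .
    then have "K #>\<^bsub>P\<^esub> e \<sigma> = K" using weighted_fst[OF W s e[OF that]] by simp
    then have "e \<sigma> \<in> K" using coset_eq_K_iff e[OF that] by simp
    moreover have "\<theta> (e \<sigma>) = F.gen \<sigma>" using E by (simp add: \<theta>_def)
    ultimately show ?thesis by (metis imageI)
  qed
  have "\<theta> ` K = carrier F.F"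
    using F.subgroup_UNIV[of "\<theta> ` K"] \<theta>.img_is_subgroup gen by simp
  moreover have "inj_on \<theta> K" using inv by (rule inj_on_inverseI)
  ultimately have "\<theta> \<in> iso (P\<lparr>carrier := K\<rparr>) F.F"
    using \<theta>.homh by (simp add: iso_def bij_betw_def)
  then show ?thesis by (auto simp: is_free_group_def is_iso_def)
qed

end

section \<open>Stabilisers\<close>

text \<open>Maps with the same fibres have images in bijection. This compares orbits with cosets,
  two hypermaps with equal stabilisers, and stabilisers with isomorphism classes.\<close>

lemma images_bij_betw:
  assumes "\<And>x y. x \<in> C \<Longrightarrow> y \<in> C \<Longrightarrow> f x = f y \<longleftrightarrow> g x = g y"
  obtains h where "bij_betw h (f ` C) (g ` C)" "\<And>x. x \<in> C \<Longrightarrow> h (f x) = g x"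
proof
  define h where "h u = g (SOME x. x \<in> C \<and> f x = u)" for u
  show h: "h (f x) = g x" if "x \<in> C" for x
    unfolding h_def using someI[of "\<lambda>y. y \<in> C \<and> f y = f x" x] that assms by auto
  show "bij_betw h (f ` C) (g ` C)"
    unfolding bij_betw_def inj_on_def image_image using h assms by (simp cong: image_cong)
qed

locale pointed_transitive_action = free_product_of_groups G H
  for G :: "('a, 'c) monoid_scheme" and H :: "('b, 'd) monoid_scheme" +
  fixes \<Omega> :: "'s set" and t b
  assumes action: "acts_on \<Omega> t"
    and base: "b \<in> \<Omega>"
    and transitive: "\<And>s. s \<in> \<Omega> \<Longrightarrow> \<exists>g\<in>carrier P. act t b g = s"
begin

definition stabiliser where
  "stabiliser = {g \<in> carrier P. act t b g = b}"

lemma act_inv: "s \<in> \<Omega> \<Longrightarrow> g \<in> carrier P \<Longrightarrow> act t (act t s g) (inv\<^bsub>P\<^esub> g) = s"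
  using act_mult'[OF action, of s g "inv\<^bsub>P\<^esub> g"] act_one'[OF action] by simp

lemma act_eq_iff:
  assumes "g \<in> carrier P" "h \<in> carrier P"
  shows "act t b g = act t b h \<longleftrightarrow> g \<otimes>\<^bsub>P\<^esub> inv\<^bsub>P\<^esub> h \<in> stabiliser"
proof -
  have eq: "act t b (g \<otimes>\<^bsub>P\<^esub> inv\<^bsub>P\<^esub> h) = act t (act t b g) (inv\<^bsub>P\<^esub> h)"
    using act_mult'[OF action base, of g "inv\<^bsub>P\<^esub> h"] assms by simp
  show ?thesis
  proof
    assume "act t b g = act t b h"
    then show "g \<otimes>\<^bsub>P\<^esub> inv\<^bsub>P\<^esub> h \<in> stabiliser"
      using eq act_inv[OF base assms(2)] assms by (simp add: stabiliser_def)
  next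
    assume "g \<otimes>\<^bsub>P\<^esub> inv\<^bsub>P\<^esub> h \<in> stabiliser"
    then have "act t (act t b g) (inv\<^bsub>P\<^esub> h) = b" using eq by (simp add: stabiliser_def)
    then show "act t b g = act t b h"
      using act_inv[of "act t b g" "inv\<^bsub>P\<^esub> h"] act_closed'[OF action base assms(1)] assms(2) by simp
  qed
qed

lemma subgroup_stabiliser: "subgroup stabiliser P"
proof (rule P.subgroupI)
  show "stabiliser \<noteq> {}" using act_one'[OF action base] by (auto simp: stabiliser_def)
  show "inv\<^bsub>P\<^esub> g \<in> stabiliser" if "g \<in> stabiliser" for g
    using that act_inv[OF base, of g] by (simp add: stabiliser_def)
  show "g \<otimes>\<^bsub>P\<^esub> h \<in> stabiliser" if "g \<in> stabiliser" "h \<in> stabiliser" for g h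
    using that act_mult'[OF action base] by (simp add: stabiliser_def)
qed (auto simp: stabiliser_def)

lemma coset_eq_iff:
  assumes "g \<in> carrier P" "h \<in> carrier P"
  shows "stabiliser #>\<^bsub>P\<^esub> g = stabiliser #>\<^bsub>P\<^esub> h \<longleftrightarrow> act t b g = act t b h"
proof
  assume "stabiliser #>\<^bsub>P\<^esub> g = stabiliser #>\<^bsub>P\<^esub> h"
  then have "g \<in> stabiliser #>\<^bsub>P\<^esub> h"
    using P.rcos_self[OF assms(1) subgroup_stabiliser] by simp
  then obtain k where "k \<in> stabiliser" "g = k \<otimes>\<^bsub>P\<^esub> h" by (auto simp: r_coset_def)
  then show "act t b g = act t b h"
    using act_mult'[OF action base, of k h] assms by (simp add: stabiliser_def)
next
  assume "act t b g = act t b h"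
  then have "g \<otimes>\<^bsub>P\<^esub> inv\<^bsub>P\<^esub> h \<in> stabiliser" using act_eq_iff assms by simp
  moreover have "g = g \<otimes>\<^bsub>P\<^esub> inv\<^bsub>P\<^esub> h \<otimes>\<^bsub>P\<^esub> h" using assms by (simp add: P.m_assoc)
  ultimately have "g \<in> stabiliser #>\<^bsub>P\<^esub> h" unfolding r_coset_def by blast
  then show "stabiliser #>\<^bsub>P\<^esub> g = stabiliser #>\<^bsub>P\<^esub> h"
    using P.repr_independence[OF _ assms(2) subgroup_stabiliser] by simp
qed

lemma act_image: "act t b ` carrier P = \<Omega>"
  using transitive act_closed'[OF action base] by (auto simp: image_iff)

lemma bij_betw_cosets: "\<exists>h. bij_betw h \<Omega> (rcosets\<^bsub>P\<^esub> stabiliser)"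
proof -
  obtain h where "bij_betw h (act t b ` carrier P) ((\<lambda>g. stabiliser #>\<^bsub>P\<^esub> g) ` carrier P)"
    using images_bij_betw[of "carrier P" "act t b" "\<lambda>g. stabiliser #>\<^bsub>P\<^esub> g"] coset_eq_iff by metis
  moreover have "(\<lambda>g. stabiliser #>\<^bsub>P\<^esub> g) ` carrier P = rcosets\<^bsub>P\<^esub> stabiliser"
    by (auto simp: RCOSETS_def)
  ultimately show ?thesis using act_image by auto
qed

lemma has_index_stabiliser: "finite \<Omega> \<Longrightarrow> has_index stabiliser P (card \<Omega>)"
  using bij_betw_cosets bij_betw_finite bij_betw_same_card by (metis has_index_def)

text \<open>A letter fixing the coset of \<open>g\<close> fixes the point \<open>act t b g\<close>,
  so free action of the factors passes from \<Omega> to the cosets of the stabiliser.\<close>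

lemma is_free_group_stabiliser:
  assumes "finite \<Omega>" and free: "\<And>s a. s \<in> \<Omega> \<Longrightarrow> a \<in> letters \<Longrightarrow> t s a = s \<Longrightarrow> letter a = \<one>\<^bsub>P\<^esub>"
  shows "is_free_group (P\<lparr>carrier := stabiliser\<rparr>)"
proof -
  interpret S: finite_index_subgroup G H stabiliser
    using subgroup_stabiliser has_index_stabiliser[OF assms(1)]
    by (intro finite_index_subgroup.intro finite_index_subgroup_axioms.intro free_product_of_groups_axioms)
      (auto simp: has_index_def)
  interpret S: semiregular_subgroup G H stabiliser
  proof
    fix x a assume x: "x \<in> rcosets\<^bsub>P\<^esub> stabiliser" and a: "a \<in> letters" and stays: "x #>\<^bsub>P\<^esub> letter a = x"
    obtain g where g: "g \<in> carrier P" "x = stabiliser #>\<^bsub>P\<^esub> g" using x by (rule S.coset_cases)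
    have "stabiliser #>\<^bsub>P\<^esub> (g \<otimes>\<^bsub>P\<^esub> letter a) = stabiliser #>\<^bsub>P\<^esub> g"
      using stays g a S.K_subset by (simp add: P.coset_mult_assoc)
    then have "act t b (g \<otimes>\<^bsub>P\<^esub> letter a) = act t b g" using coset_eq_iff g a by simp
    moreover have "act t b (g \<otimes>\<^bsub>P\<^esub> letter a) = t (act t b g) a"
      using act_mult'[OF action base g(1)] act_letter[OF action act_closed'[OF action base g(1)] a] a
      by (simp add: letter_def[symmetric])
    ultimately show "letter a = \<one>\<^bsub>P\<^esub>" using free[OF act_closed'[OF action base g(1)] a] by simp
  qed
  show ?thesis by (rule S.is_free_group_K)
qed

end

section \<open>Cycles of permutations\<close>

lemma card_orbit:
  assumes "inj f" "(f ^^ k) x = x" "0 < k" "\<And>m. 0 < m \<Longrightarrow> m < k \<Longrightarrow> (f ^^ m) x \<noteq> x"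
  shows "card (orbit f x) = k"
proof -
  have ne: "(f ^^ i) x \<noteq> (f ^^ j) x" if "i < j" "j < k" for i j
  proof
    assume "(f ^^ i) x = (f ^^ j) x"
    then have "(f ^^ i) x = (f ^^ i) ((f ^^ (j - i)) x)"
      using that funpow_add[of i "j - i" f] by simp
    then have "x = (f ^^ (j - i)) x" using inj_fn[OF assms(1), of i] by (simp add: inj_eq)
    moreover have "j - i < k" using that by linarith
    ultimately show False using assms(4)[of "j - i"] that by simp
  qed
  have "orbit f x = (\<lambda>m. (f ^^ m) x) ` {..<k}"
    using orbit_altdef_bounded[OF assms(2,3)] by auto
  moreover have "inj_on (\<lambda>m. (f ^^ m) x) {..<k}"
    by (rule linorder_inj_onI) (use ne in auto)
  ultimately show ?thesis by (simp add: card_image)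
qed

text \<open>The length of a cycle is the least positive return time of its points. In terms of
  powers, the condition splits into the relation of a cyclic factor and the freeness of its
  action.\<close>

lemma all_cycles_have_length_iff:
  assumes \<pi>: "\<pi> permutes {1..n}" and "k > 0"
  shows "all_cycles_have_length n \<pi> k \<longleftrightarrow>
    (\<forall>i\<in>{1..n}. (\<pi> ^^ k) i = i \<and> (\<forall>m. 0 < m \<longrightarrow> m < k \<longrightarrow> (\<pi> ^^ m) i \<noteq> i))"
proof
  assume L: "all_cycles_have_length n \<pi> k"
  show "\<forall>i\<in>{1..n}. (\<pi> ^^ k) i = i \<and> (\<forall>m. 0 < m \<longrightarrow> m < k \<longrightarrow> (\<pi> ^^ m) i \<noteq> i)"
  proof
    fix i assume i: "i \<in> {1..n}"
    have "permutation \<pi>" using \<pi> by (auto simp: permutation_permutes)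
    then have "i \<in> orbit \<pi> i" by (rule permutation_self_in_orbit)
    then have ex: "\<exists>N. 0 < N \<and> (\<pi> ^^ N) i = i" by (auto simp: orbit_altdef)
    define N where "N = (LEAST N. 0 < N \<and> (\<pi> ^^ N) i = i)"
    have N: "0 < N" "(\<pi> ^^ N) i = i" using LeastI_ex[OF ex] by (auto simp: N_def)
    have min: "(\<pi> ^^ m) i \<noteq> i" if "0 < m" "m < N" for m
      using that not_less_Least[of m "\<lambda>N. 0 < N \<and> (\<pi> ^^ N) i = i"] by (auto simp: N_def)
    have "card (orbit \<pi> i) = N"
      by (rule card_orbit) (use N min permutes_inj[OF \<pi>] in auto)
    then have "N = k" using L i by (auto simp: all_cycles_have_length_def)
    then show "(\<pi> ^^ k) i = i \<and> (\<forall>m. 0 < m \<longrightarrow> m < k \<longrightarrow> (\<pi> ^^ m) i \<noteq> i)" using N min by auto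
  qed
next
  assume "\<forall>i\<in>{1..n}. (\<pi> ^^ k) i = i \<and> (\<forall>m. 0 < m \<longrightarrow> m < k \<longrightarrow> (\<pi> ^^ m) i \<noteq> i)"
  then show "all_cycles_have_length n \<pi> k"
    unfolding all_cycles_have_length_def
    using card_orbit[OF permutes_inj[OF \<pi>] _ \<open>k > 0\<close>] by blast
qed

lemma equiv_rooted_isomorphism: "equiv (labelled_hypermaps n) (rooted_isomorphism n)"
proof (rule equivI)
  show "rooted_isomorphism n \<subseteq> labelled_hypermaps n \<times> labelled_hypermaps n"
    by (auto simp: rooted_isomorphism_def)
  show "refl_on (labelled_hypermaps n) (rooted_isomorphism n)"
    by (auto simp: refl_on_def rooted_isomorphism_def permutes_id intro!: exI[of _ id])
  show "sym (rooted_isomorphism n)"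
  proof (rule symI)
    fix c d assume "(c, d) \<in> rooted_isomorphism n"
    then obtain \<alpha> \<phi> \<psi> where c: "c = (\<alpha>, \<phi>)" "d = (\<psi> \<circ> \<alpha> \<circ> inv' \<psi>, \<psi> \<circ> \<phi> \<circ> inv' \<psi>)"
      and l: "c \<in> labelled_hypermaps n" "d \<in> labelled_hypermaps n"
      and \<psi>: "\<psi> permutes {1..n}" "\<psi> 1 = 1"
      by (auto simp: rooted_isomorphism_def)
    have "inv' \<psi> permutes {1..n}" "inv' \<psi> 1 = 1" "inv' (inv' \<psi>) = \<psi>" "inv' \<psi> \<circ> \<psi> = id"
      using \<psi> permutes_inv[OF \<psi>(1)] permutes_inv_eq[OF \<psi>(1)] permutes_inv_inv[OF \<psi>(1)]
        permutes_inv_o[OF \<psi>(1)] by auto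
    moreover from this have "\<alpha> = inv' \<psi> \<circ> (\<psi> \<circ> \<alpha> \<circ> inv' \<psi>) \<circ> \<psi>" "\<phi> = inv' \<psi> \<circ> (\<psi> \<circ> \<phi> \<circ> inv' \<psi>) \<circ> \<psi>"
      by (simp_all add: fun_eq_iff)
    ultimately show "(d, c) \<in> rooted_isomorphism n"
      using l unfolding c rooted_isomorphism_def by (auto intro!: exI[of _ "inv' \<psi>"])
  qed
  show "trans (rooted_isomorphism n)"
  proof (rule transI)
    fix c d e assume "(c, d) \<in> rooted_isomorphism n" "(d, e) \<in> rooted_isomorphism n"
    then obtain \<alpha> \<phi> \<psi> \<chi> where c: "c = (\<alpha>, \<phi>)"
        "e = (\<chi> \<circ> (\<psi> \<circ> \<alpha> \<circ> inv' \<psi>) \<circ> inv' \<chi>, \<chi> \<circ> (\<psi> \<circ> \<phi> \<circ> inv' \<psi>) \<circ> inv' \<chi>)"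
      and l: "c \<in> labelled_hypermaps n" "e \<in> labelled_hypermaps n"
      and \<psi>: "\<psi> permutes {1..n}" "\<psi> 1 = 1" and \<chi>: "\<chi> permutes {1..n}" "\<chi> 1 = 1"
      by (auto simp: rooted_isomorphism_def)
    have "inv' (\<chi> \<circ> \<psi>) = inv' \<psi> \<circ> inv' \<chi>"
      using o_inv_distrib permutes_bij \<psi>(1) \<chi>(1) by blast
    then have "\<exists>\<omega>. \<omega> permutes {1..n} \<and> \<omega> 1 = 1 \<and> fst e = \<omega> \<circ> \<alpha> \<circ> inv' \<omega> \<and> snd e = \<omega> \<circ> \<phi> \<circ> inv' \<omega>"
      using \<psi> \<chi> c by (intro exI[of _ "\<chi> \<circ> \<psi>"]) (auto simp: permutes_compose comp_assoc)
    then show "(c, e) \<in> rooted_isomorphism n"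
      using l unfolding c rooted_isomorphism_def by auto
  qed
qed

section \<open>Rooted hypermaps and stabilisers\<close>

text \<open>A residue is represented by an integer from 0 to \<open>p - 1\<close> or
  \<open>q - 1\<close>, and \<open>nat\<close> turns it into an exponent.\<close>

definition hypermap_step :: "(nat \<Rightarrow> nat) \<times> (nat \<Rightarrow> nat) \<Rightarrow> nat \<Rightarrow> int + int \<Rightarrow> nat" where
  "hypermap_step = (\<lambda>(\<alpha>, \<phi>) i. case_sum (\<lambda>k. (\<alpha> ^^ nat k) i) (\<lambda>k. (\<phi> ^^ nat k) i))"

text \<open>Positivity makes both factors finite: for modulus 0, \<open>integer_mod_group\<close> is
  the group of integers.\<close>

locale hypermap_type =
  fixes p q :: nat
  assumes p: "p > 0" and q: "q > 0"
begin

sublocale free_product_of_groups "integer_mod_group p" "integer_mod_group q"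
  by (intro free_product_of_groups.intro group_integer_mod_group)

lemma letters_eq: "letters = Inl ` {0..<int p} \<union> Inr ` {0..<int q}"
  using p q by (auto simp: free_product_alphabet_def carrier_integer_mod_group)

text \<open>\<open>1 mod int p\<close> is the generator in its normal form; for \<open>p = 1\<close>
  it is 0, the unit.\<close>

lemma letter_pow:
  "letter (Inl (int m mod int p)) = letter (Inl (1 mod int p)) [^]\<^bsub>P\<^esub> m"
  "letter (Inr (int m mod int q)) = letter (Inr (1 mod int q)) [^]\<^bsub>P\<^esub> m"
proof -
  have "(\<lambda>x. letter (Inl x)) \<in> hom (integer_mod_group p) P"
    "(\<lambda>x. letter (Inr x)) \<in> hom (integer_mod_group q) P"
    by (auto simp: hom_def letter_mult[simplified])
  then show "letter (Inl (int m mod int p)) = letter (Inl (1 mod int p)) [^]\<^bsub>P\<^esub> m"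
    "letter (Inr (int m mod int q)) = letter (Inr (1 mod int q)) [^]\<^bsub>P\<^esub> m"
    using hom_nat_pow[of "\<lambda>x. letter (Inl x)" "integer_mod_group p" P "1 mod int p" m]
      hom_nat_pow[of "\<lambda>x. letter (Inr x)" "integer_mod_group q" P "1 mod int q" m] p q
    by (auto simp: carrier_integer_mod_group mod_mult_right_eq P.is_group)
qed

text \<open>The exponent \<open>p * q\<close> serves the letters of both factors at once.\<close>

lemma letter_torsion: "a \<in> letters \<Longrightarrow> letter a [^]\<^bsub>P\<^esub> (p * q) = \<one>\<^bsub>P\<^esub>"
proof -
  assume a: "a \<in> letters"
  obtain k where k: "k \<ge> 0" "letter a = letter (Inl (1 mod int p)) [^]\<^bsub>P\<^esub> nat k \<or>
      letter a = letter (Inr (1 mod int q)) [^]\<^bsub>P\<^esub> nat k"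
  proof (cases a)
    case (Inl k)
    then show thesis using that[of k] a letter_pow(1)[of "nat k"] by (auto simp: letters_eq)
  next
    case (Inr k)
    then show thesis using that[of k] a letter_pow(2)[of "nat k"] by (auto simp: letters_eq)
  qed
  have l: "letter (Inl (1 mod int p)) \<in> carrier P" "letter (Inr (1 mod int q)) \<in> carrier P"
    using p q by (auto simp: letters_eq intro!: letter_closed)
  have "letter (Inl (1 mod int p)) [^]\<^bsub>P\<^esub> (nat k * (p * q)) = \<one>\<^bsub>P\<^esub>"
    "letter (Inr (1 mod int q)) [^]\<^bsub>P\<^esub> (nat k * (p * q)) = \<one>\<^bsub>P\<^esub>"
    using letter_pow[of "nat k * (p * q)"] letter_one by simp_all
  then show ?thesis using k(2) l by (auto simp: P.nat_pow_pow)
qed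

text \<open>A letter that fixes the coset of \<open>g\<close> has its conjugate by \<open>g\<close>
  in \<open>K\<close>. The conjugate has finite order, so it is trivial in a free group.\<close>

lemma semiregular_if_free:
  assumes "subgroup K P" "is_free_group (P\<lparr>carrier := K\<rparr>)"
    and "x \<in> rcosets\<^bsub>P\<^esub> K" and a: "a \<in> letters" and stays: "x #>\<^bsub>P\<^esub> letter a = x"
  shows "letter a = \<one>\<^bsub>P\<^esub>"
proof -
  note K_subset = subgroup.subset[OF assms(1)]
  interpret K: group "P\<lparr>carrier := K\<rparr>"
    using assms(1) P.is_group by (rule subgroup.subgroup_is_group)
  obtain g where g: "g \<in> carrier P" "x = K #>\<^bsub>P\<^esub> g" using assms(3) by (auto simp: RCOSETS_def)
  have l: "letter a \<in> carrier P" using a by auto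
  let ?k = "g \<otimes>\<^bsub>P\<^esub> letter a \<otimes>\<^bsub>P\<^esub> inv\<^bsub>P\<^esub> g"
  have "K #>\<^bsub>P\<^esub> (g \<otimes>\<^bsub>P\<^esub> letter a) = K #>\<^bsub>P\<^esub> g"
    using stays g l K_subset by (simp add: P.coset_mult_assoc)
  then have "K #>\<^bsub>P\<^esub> ?k = K #>\<^bsub>P\<^esub> g #>\<^bsub>P\<^esub> inv\<^bsub>P\<^esub> g"
    using P.coset_mult_assoc[OF K_subset, of "g \<otimes>\<^bsub>P\<^esub> letter a" "inv\<^bsub>P\<^esub> g"] g l by simp
  also have "\<dots> = K" using g K_subset by (simp add: P.coset_mult_assoc)
  finally have "K #>\<^bsub>P\<^esub> ?k = K" .
  then have k: "?k \<in> K" using P.coset_join1[OF _ _ assms(1)] g l by simp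
  have "?k [^]\<^bsub>P\<lparr>carrier := K\<rparr>\<^esub> (p * q) = \<one>\<^bsub>P\<lparr>carrier := K\<rparr>\<^esub>"
    using P.nat_pow_conj[OF g(1) l, of "p * q"] letter_torsion[OF a] g
    by (simp add: P.nat_pow_consistent[symmetric])
  then have "?k = \<one>\<^bsub>P\<^esub>"
    using is_free_group_torsion_free[OF K.is_group assms(2), of ?k "p * q"] k p q by simp
  moreover have "?k \<otimes>\<^bsub>P\<^esub> g = g \<otimes>\<^bsub>P\<^esub> letter a" using g l by (simp add: P.m_assoc)
  ultimately have "g \<otimes>\<^bsub>P\<^esub> letter a = g \<otimes>\<^bsub>P\<^esub> \<one>\<^bsub>P\<^esub>" using g by simp
  then show ?thesis using g l by (simp del: P.r_one)
qed

end

locale rooted_hypermap = hypermap_type +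
  fixes n :: nat and \<alpha> \<phi>
  assumes hypermap: "(\<alpha>, \<phi>) \<in> connected_rooted_hypermaps p q n"
begin

lemma perm: "\<alpha> permutes {1..n}" "\<phi> permutes {1..n}"
  using hypermap by (auto simp: connected_rooted_hypermaps_def labelled_hypermaps_def)

lemma n: "1 \<in> {1..n}"
  using hypermap by (auto simp: connected_rooted_hypermaps_def)

lemma cycles:
  assumes "i \<in> {1..n}"
  shows "(\<alpha> ^^ p) i = i" "(\<phi> ^^ q) i = i"
    "0 < m \<Longrightarrow> m < p \<Longrightarrow> (\<alpha> ^^ m) i \<noteq> i" "0 < m \<Longrightarrow> m < q \<Longrightarrow> (\<phi> ^^ m) i \<noteq> i"
  using hypermap assms all_cycles_have_length_iff[OF perm(1) p] all_cycles_have_length_iff[OF perm(2) q]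
  by (auto simp: connected_rooted_hypermaps_def)

lemma step_action: "acts_on {1..n} (hypermap_step (\<alpha>, \<phi>))"
proof -
  have mod: "(f ^^ nat ((x + y) mod int k)) i = (f ^^ nat y) ((f ^^ nat x) i)"
    if "x \<in> {0..<int k}" "y \<in> {0..<int k}" "(f ^^ k) i = i" for f :: "nat \<Rightarrow> nat" and k x y i
  proof -
    have "nat ((x + y) mod int k) = (nat y + nat x) mod k"
      using that by (simp add: nat_mod_distrib nat_add_distrib add.commute)
    then show ?thesis using funpow_mod_eq[OF that(3)] by (simp add: funpow_add)
  qed
  have "(\<alpha> ^^ m) i \<in> {1..n}" "(\<phi> ^^ m) i \<in> {1..n}" if "i \<in> {1..n}" for m i
    using that perm[THEN permutes_funpow] permutes_in_image by metis+
  then show ?thesis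
    by (intro acts_onI)
      (use p q cycles in \<open>auto simp: hypermap_step_def mod
        carrier_integer_mod_group letters_eq\<close>)
qed

lemma act_generator:
  assumes "i \<in> {1..n}"
  shows "act (hypermap_step (\<alpha>, \<phi>)) i (letter (Inl (1 mod int p))) = \<alpha> i"
    "act (hypermap_step (\<alpha>, \<phi>)) i (letter (Inr (1 mod int q))) = \<phi> i"
proof -
  have "Inl (1 mod int p) \<in> letters" "Inr (1 mod int q) \<in> letters"
    using p q by (auto simp: letters_eq)
  then have "act (hypermap_step (\<alpha>, \<phi>)) i (letter (Inl (1 mod int p))) = (\<alpha> ^^ nat (1 mod int p)) i"
    "act (hypermap_step (\<alpha>, \<phi>)) i (letter (Inr (1 mod int q))) = (\<phi> ^^ nat (1 mod int q)) i"
    using act_letter[OF step_action assms] by (simp_all add: letter_def hypermap_step_def)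
  \<comment> \<open>For \<open>p = 1\<close> the exponent is 0 instead of 1, which makes no
    difference because the \<open>p\<close>-th power of \<alpha> fixes \<open>i\<close>; likewise
    for \<phi>.\<close>
  moreover have "nat (1 mod int p) = 1 mod p" "nat (1 mod int q) = 1 mod q"
    by (simp_all add: nat_mod_distrib)
  ultimately show "act (hypermap_step (\<alpha>, \<phi>)) i (letter (Inl (1 mod int p))) = \<alpha> i"
    "act (hypermap_step (\<alpha>, \<phi>)) i (letter (Inr (1 mod int q))) = \<phi> i"
    using funpow_mod_eq[OF cycles(1)[OF assms], of 1] funpow_mod_eq[OF cycles(2)[OF assms], of 1]
    by simp_all
qed

text \<open>The element \<open>g\<close> may depend on the dart \<open>i\<close>: transitivity asks
  for nothing uniform. In a composition the element for the inner permutation comes first, since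
  \<open>P\<close> acts from the right.\<close>

lemma generate_act:
  assumes "\<pi> \<in> generate (sym_group n) {\<alpha>, \<phi>}"
  shows "\<pi> permutes {1..n} \<and> (\<forall>i\<in>{1..n}. \<exists>g\<in>carrier P. act (hypermap_step (\<alpha>, \<phi>)) i g = \<pi> i)"
proof -
  interpret Sym: group "sym_group n" by (rule sym_group_is_group)
  have gens: "\<alpha> \<in> carrier (sym_group n)" "\<phi> \<in> carrier (sym_group n)"
    using perm by (simp_all add: sym_group_carrier)
  have gl: "letter (Inl (1 mod int p)) \<in> carrier P" "letter (Inr (1 mod int q)) \<in> carrier P"
    using p q by (auto simp: letters_eq intro!: letter_closed)
  have gen: "\<exists>g\<in>carrier P. \<forall>i\<in>{1..n}. act (hypermap_step (\<alpha>, \<phi>)) i g = h i" if "h \<in> {\<alpha>, \<phi>}" for h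
    using act_generator gl that by blast
  show ?thesis
    using assms
  proof induction
    case one
    show ?case
      unfolding sym_group_one using act_one'[OF step_action] permutes_id P.one_closed by (metis id_apply)
  next
    case (incl h)
    then show ?case using gen[OF incl] perm by auto
  next
    case (inv h)
    let ?h = "inv\<^bsub>sym_group n\<^esub> h"
    have hc: "h \<in> carrier (sym_group n)" using inv gens by auto
    then have hp: "?h permutes {1..n}" using Sym.inv_closed by (simp add: sym_group_carrier)
    have hh: "h (?h i) = i" for i
      using Sym.r_inv[OF hc] by (simp add: sym_group_mult sym_group_one fun_eq_iff)
    obtain g where g: "g \<in> carrier P" "\<And>i. i \<in> {1..n} \<Longrightarrow> act (hypermap_step (\<alpha>, \<phi>)) i g = h i"
      using gen[OF inv] by blast
    have "act (hypermap_step (\<alpha>, \<phi>)) i (inv\<^bsub>P\<^esub> g) = ?h i" if i: "i \<in> {1..n}" for i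
    proof -
      have j: "?h i \<in> {1..n}" using hp i permutes_in_image by metis
      have "act (hypermap_step (\<alpha>, \<phi>)) (?h i) (g \<otimes>\<^bsub>P\<^esub> inv\<^bsub>P\<^esub> g) = act (hypermap_step (\<alpha>, \<phi>)) i (inv\<^bsub>P\<^esub> g)"
        using act_mult'[OF step_action j g(1), of "inv\<^bsub>P\<^esub> g"] g j hh by simp
      then show ?thesis using g(1) act_one'[OF step_action j] by simp
    qed
    then show ?case using hp g(1) by blast
  next
    case (eng h1 h2)
    have "\<exists>g\<in>carrier P. act (hypermap_step (\<alpha>, \<phi>)) i g = h1 (h2 i)" if i: "i \<in> {1..n}" for i
    proof -
      have j: "h2 i \<in> {1..n}" using eng i permutes_in_image by metis
      obtain g2 where "g2 \<in> carrier P" "act (hypermap_step (\<alpha>, \<phi>)) i g2 = h2 i" using eng i by blast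
      moreover obtain g1 where "g1 \<in> carrier P" "act (hypermap_step (\<alpha>, \<phi>)) (h2 i) g1 = h1 (h2 i)"
        using eng j by blast
      ultimately show ?thesis
        using act_mult'[OF step_action i, of g2 g1] by (intro bexI[of _ "g2 \<otimes>\<^bsub>P\<^esub> g1"]) auto
    qed
    then have "\<forall>i\<in>{1..n}. \<exists>g\<in>carrier P. act (hypermap_step (\<alpha>, \<phi>)) i g = (h1 \<circ> h2) i" by simp
    moreover have "h1 \<circ> h2 permutes {1..n}" using eng permutes_compose by blast
    ultimately show ?case unfolding sym_group_mult by blast
  qed
qed

sublocale pointed_transitive_action "integer_mod_group p" "integer_mod_group q"
  "{1..n}" "hypermap_step (\<alpha>, \<phi>)" 1
proof
  show "\<exists>g\<in>carrier P. act (hypermap_step (\<alpha>, \<phi>)) 1 g = j" if "j \<in> {1..n}" for j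
  proof -
    have "connected_hypermap n (\<alpha>, \<phi>)"
      using hypermap by (simp add: connected_rooted_hypermaps_def)
    from this[unfolded connected_hypermap_def, unfolded prod.case, rule_format, OF n that]
    obtain \<pi> where "\<pi> \<in> generate (sym_group n) {\<alpha>, \<phi>}" "\<pi> 1 = j"
      by blast
    then show ?thesis using generate_act[of \<pi>] n by metis
  qed
qed (use step_action n in auto)

text \<open>As all cycles have full length, a residue that fixes a dart is 0, so both factors act
  freely on the darts.\<close>

lemma stabiliser_free_subgroup: "stabiliser \<in> free_subgroups_of_index P n"
proof -
  have "is_free_group (P\<lparr>carrier := stabiliser\<rparr>)"
  proof (rule is_free_group_stabiliser)
    fix i a assume i: "i \<in> {1..n}" and a: "a \<in> letters" and stays: "hypermap_step (\<alpha>, \<phi>) i a = i"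
    show "letter a = \<one>\<^bsub>P\<^esub>"
    proof (cases a)
      case (Inl k)
      then have "k = 0" using a stays cycles(3)[OF i, of "nat k"] by (force simp: letters_eq hypermap_step_def)
      then show ?thesis using letter_one Inl by simp
    next
      case (Inr k)
      then have "k = 0" using a stays cycles(4)[OF i, of "nat k"] by (force simp: letters_eq hypermap_step_def)
      then show ?thesis using letter_one Inr by simp
    qed
  qed simp
  then show ?thesis
    using subgroup_stabiliser has_index_stabiliser by (simp add: free_subgroups_of_index_def)
qed

end

section \<open>Stabilisers as complete invariants of rooted hypermaps\<close>

context hypermap_type
begin

definition hypermap_stabiliser :: "(nat \<Rightarrow> nat) \<times> (nat \<Rightarrow> nat) \<Rightarrow> (int + int) list set set" where
  "hypermap_stabiliser c = {g \<in> carrier P. act (hypermap_step c) 1 g = 1}"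

lemma rooted_hypermapI: "(\<alpha>, \<phi>) \<in> connected_rooted_hypermaps p q n \<Longrightarrow> rooted_hypermap p q n \<alpha> \<phi>"
  by unfold_locales

lemma hypermap_stabiliser_eq:
  assumes "(\<alpha>, \<phi>) \<in> connected_rooted_hypermaps p q n"
  shows "pointed_transitive_action.stabiliser (integer_mod_group p) (integer_mod_group q)
    (hypermap_step (\<alpha>, \<phi>)) 1 = hypermap_stabiliser (\<alpha>, \<phi>)"
proof -
  interpret A: rooted_hypermap p q n \<alpha> \<phi> by (rule rooted_hypermapI[OF assms])
  show ?thesis unfolding A.stabiliser_def hypermap_stabiliser_def ..
qed

text \<open>An isomorphism fixing the root intertwines the two actions. Conversely, if the
  stabilisers agree, two group elements move the root alike in one hypermap iff they do in the
  other, which defines the relabelling.\<close>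

lemma hypermap_stabiliser_eq_iff:
  assumes c: "(\<alpha>, \<phi>) \<in> connected_rooted_hypermaps p q n"
    and d: "(\<beta>, \<chi>) \<in> connected_rooted_hypermaps p q n"
  shows "hypermap_stabiliser (\<alpha>, \<phi>) = hypermap_stabiliser (\<beta>, \<chi>) \<longleftrightarrow>
    ((\<alpha>, \<phi>), (\<beta>, \<chi>)) \<in> rooted_isomorphism n"
proof
  interpret A: rooted_hypermap p q n \<alpha> \<phi> by (rule rooted_hypermapI[OF c])
  interpret B: rooted_hypermap p q n \<beta> \<chi> by (rule rooted_hypermapI[OF d])
  have lab: "(\<alpha>, \<phi>) \<in> labelled_hypermaps n" "(\<beta>, \<chi>) \<in> labelled_hypermaps n"
    using A.perm B.perm by (auto simp: labelled_hypermaps_def)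
  show "hypermap_stabiliser (\<alpha>, \<phi>) = hypermap_stabiliser (\<beta>, \<chi>)"
    if "((\<alpha>, \<phi>), (\<beta>, \<chi>)) \<in> rooted_isomorphism n"
  proof -
    obtain \<psi> where \<psi>: "\<psi> permutes {1..n}" "\<psi> 1 = 1" "\<beta> = \<psi> \<circ> \<alpha> \<circ> inv' \<psi>" "\<chi> = \<psi> \<circ> \<phi> \<circ> inv' \<psi>"
      using \<open>((\<alpha>, \<phi>), (\<beta>, \<chi>)) \<in> rooted_isomorphism n\<close> by (auto simp: rooted_isomorphism_def)
    have "(\<psi> \<circ> f \<circ> inv' \<psi>) (\<psi> i) = \<psi> (f i)" for f i
      using permutes_inverses(2)[OF \<psi>(1)] by simp
    then have "\<beta> (\<psi> i) = \<psi> (\<alpha> i)" "\<chi> (\<psi> i) = \<psi> (\<phi> i)" for i using \<psi> by auto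
    then have "(\<beta> ^^ m) (\<psi> i) = \<psi> ((\<alpha> ^^ m) i)" "(\<chi> ^^ m) (\<psi> i) = \<psi> ((\<phi> ^^ m) i)" for m i
      by (induction m; simp)+
    then have step: "\<psi> (hypermap_step (\<alpha>, \<phi>) i a) = hypermap_step (\<beta>, \<chi>) (\<psi> i) a" for i a
      by (cases a) (auto simp: hypermap_step_def)
    have "\<psi> i \<in> {1..n}" if "i \<in> {1..n}" for i using \<psi>(1) that permutes_in_image by metis
    then have "\<psi> (act (hypermap_step (\<alpha>, \<phi>)) 1 g) = act (hypermap_step (\<beta>, \<chi>)) (\<psi> 1) g" if "g \<in> carrier P" for g
      using act_morphism'[OF A.step_action B.step_action] A.n that step by blast
    then have "act (hypermap_step (\<beta>, \<chi>)) 1 g = 1 \<longleftrightarrow> act (hypermap_step (\<alpha>, \<phi>)) 1 g = 1" if "g \<in> carrier P" for g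
      using that \<psi>(2) permutes_inj[OF \<psi>(1)] by (metis injD)
    then show ?thesis by (auto simp: hypermap_stabiliser_def)
  qed
  show "((\<alpha>, \<phi>), (\<beta>, \<chi>)) \<in> rooted_isomorphism n"
    if "hypermap_stabiliser (\<alpha>, \<phi>) = hypermap_stabiliser (\<beta>, \<chi>)"
  proof -
    let ?s = "act (hypermap_step (\<alpha>, \<phi>)) 1" and ?t = "act (hypermap_step (\<beta>, \<chi>)) 1"
    have "?s g = ?s h \<longleftrightarrow> ?t g = ?t h" if "g \<in> carrier P" "h \<in> carrier P" for g h
      using A.act_eq_iff[OF that] B.act_eq_iff[OF that] hypermap_stabiliser_eq[OF c] hypermap_stabiliser_eq[OF d]
        \<open>hypermap_stabiliser (\<alpha>, \<phi>) = hypermap_stabiliser (\<beta>, \<chi>)\<close> by simp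
    then obtain h where h: "bij_betw h {1..n} {1..n}" and hs: "\<And>g. g \<in> carrier P \<Longrightarrow> h (?s g) = ?t g"
      using images_bij_betw[of "carrier P" ?s ?t] A.act_image B.act_image by metis
    \<comment> \<open>Extended by the identity, since \<open>permutes\<close> prescribes the values
      outside \<open>{1..n}\<close>.\<close>
    define \<psi> where "\<psi> i = (if i \<in> {1..n} then h i else i)" for i
    have "bij_betw \<psi> {1..n} {1..n}" using h by (rule bij_betw_cong[THEN iffD1, rotated]) (simp add: \<psi>_def)
    then have \<psi>: "\<psi> permutes {1..n}" by (rule bij_imp_permutes) (auto simp: \<psi>_def)
    have s_in: "?s g \<in> {1..n}" if "g \<in> carrier P" for g
      using act_closed'[OF A.step_action A.n that] .
    have \<psi>s: "\<psi> (?s g) = ?t g" if "g \<in> carrier P" for g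
      using s_in[OF that] hs[OF that] by (simp add: \<psi>_def)
    have \<psi>1: "\<psi> 1 = 1"
      using \<psi>s[OF P.one_closed] act_one'[OF A.step_action A.n] act_one'[OF B.step_action B.n] by simp
    have gl: "letter (Inl (1 mod int p)) \<in> carrier P" "letter (Inr (1 mod int q)) \<in> carrier P"
      using p q by (auto simp: letters_eq intro!: letter_closed)
    have comm: "\<psi> (\<alpha> i) = \<beta> (\<psi> i) \<and> \<psi> (\<phi> i) = \<chi> (\<psi> i)" for i
    proof (cases "i \<in> {1..n}")
      case True
      then obtain g where g: "g \<in> carrier P" "?s g = i" using A.transitive by blast
      have t_in: "?t g \<in> {1..n}" using act_closed'[OF B.step_action B.n g(1)] .
      have "\<psi> (?s (g \<otimes>\<^bsub>P\<^esub> l)) = act (hypermap_step (\<beta>, \<chi>)) (\<psi> i) l" if "l \<in> carrier P" for l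
        using \<psi>s[of "g \<otimes>\<^bsub>P\<^esub> l"] \<psi>s[OF g(1)] g that act_mult'[OF B.step_action B.n g(1) that] by simp
      moreover have "?s (g \<otimes>\<^bsub>P\<^esub> l) = act (hypermap_step (\<alpha>, \<phi>)) i l" if "l \<in> carrier P" for l
        using act_mult'[OF A.step_action A.n g(1) that] g by simp
      ultimately have "\<psi> (act (hypermap_step (\<alpha>, \<phi>)) i l) = act (hypermap_step (\<beta>, \<chi>)) (\<psi> i) l"
        if "l \<in> carrier P" for l using that by metis
      moreover have "\<psi> i \<in> {1..n}" using t_in \<psi>s[OF g(1)] g by simp
      ultimately show ?thesis
        using gl A.act_generator[OF True] B.act_generator[of "\<psi> i"] by metis
    next
      case False
      then show ?thesis
        using permutes_not_in[OF A.perm(1)] permutes_not_in[OF A.perm(2)]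
          permutes_not_in[OF B.perm(1)] permutes_not_in[OF B.perm(2)] by (auto simp: \<psi>_def)
    qed
    have "\<psi> (inv' \<psi> i) = i" for i using permutes_inverses(1)[OF \<psi>] .
    then have "\<beta> = \<psi> \<circ> \<alpha> \<circ> inv' \<psi>" "\<chi> = \<psi> \<circ> \<phi> \<circ> inv' \<psi>" using comm by (simp_all add: fun_eq_iff)
    then show ?thesis using \<psi> \<psi>1 lab unfolding rooted_isomorphism_def by blast
  qed
qed

lemma ex_hypermap_with_stabiliser:
  assumes "K \<in> free_subgroups_of_index P n"
  shows "\<exists>c\<in>connected_rooted_hypermaps p q n. hypermap_stabiliser c = K"
proof -
  have K: "subgroup K P" "is_free_group (P\<lparr>carrier := K\<rparr>)"
    and fin: "finite (rcosets\<^bsub>P\<^esub> K)" and card: "card (rcosets\<^bsub>P\<^esub> K) = n"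
    using assms by (auto simp: free_subgroups_of_index_def has_index_def)
  interpret K: finite_index_subgroup "integer_mod_group p" "integer_mod_group q" K
    by (intro finite_index_subgroup.intro finite_index_subgroup_axioms.intro
        free_product_of_groups_axioms K fin)
  let ?X = "rcosets\<^bsub>P\<^esub> K"
  note K_coset = K.K_coset
  \<comment> \<open>\<open>K\<close> is itself a coset, so the index is positive and the root
    exists.\<close>
  have n: "1 \<in> {1..n}"
    using K_coset card fin by (cases n) auto
  obtain e0 where e0: "bij_betw e0 ?X {1..n}"
    using ex_bij_betw_finite_nat[OF fin] bij_betw_iff_card[OF fin, of "{1..n}"] card by auto
  then have "e0 K \<in> {1..n}" using K_coset by (auto dest: bij_betwE)
  \<comment> \<open>A transposition corrects an arbitrary numbering so that \<open>K\<close>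
    receives the number 1.\<close>
  define e where "e = transpose (e0 K) 1 \<circ> e0"
  have e: "bij_betw e ?X {1..n}"
    unfolding e_def using \<open>e0 K \<in> {1..n}\<close> n
    by (intro bij_betw_trans[OF e0] permutes_imp_bij permutes_swap_id)
  have eK: "e K = 1" by (simp add: e_def)
  define d where "d = inv_into ?X e"
  have d: "d i \<in> ?X" "e (d i) = i" if "i \<in> {1..n}" for i
    using e that bij_betw_inv_into_right[OF e] bij_betw_inv_into[OF e] by (auto simp: d_def dest: bij_betwE)
  have de: "d (e x) = x" if "x \<in> ?X" for x
    using bij_betw_inv_into_left[OF e that] by (simp add: d_def)
  have e_in: "e x \<in> {1..n}" if "x \<in> ?X" for x using e that by (auto dest: bij_betwE)
  define \<tau> where "\<tau> g i = (if i \<in> {1..n} then e (d i #>\<^bsub>P\<^esub> g) else i)" for g i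
  have \<tau>_in: "\<tau> g i \<in> {1..n}" if "g \<in> carrier P" "i \<in> {1..n}" for g i
    using that d K.coset_closed e_in unfolding \<tau>_def by simp
  have \<tau>_e: "\<tau> g (e x) = e (x #>\<^bsub>P\<^esub> g)" if "x \<in> ?X" for g x
    using e_in[OF that] de[OF that] by (simp add: \<tau>_def)
  \<comment> \<open>Multiplication of cosets from the right makes \<tau> an
    anti-homomorphism.\<close>
  have \<tau>_mult: "\<tau> (g \<otimes>\<^bsub>P\<^esub> h) = \<tau> h \<circ> \<tau> g" if gh: "g \<in> carrier P" "h \<in> carrier P" for g h
  proof
    fix i
    show "\<tau> (g \<otimes>\<^bsub>P\<^esub> h) i = (\<tau> h \<circ> \<tau> g) i"
    proof (cases "i \<in> {1..n}")
      case True
      then obtain x where "x \<in> ?X" "i = e x" using d by metis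
      then show ?thesis using gh \<tau>_e K.coset_closed K.coset_mult by simp
    next
      case False
      then have "\<tau> g i = i" for g unfolding \<tau>_def by (rule if_not_P)
      then show ?thesis by simp
    qed
  qed
  have \<tau>_one: "\<tau> \<one>\<^bsub>P\<^esub> = id"
    using d K.coset_one by (auto simp: \<tau>_def fun_eq_iff)
  have \<tau>_perm: "\<tau> g permutes {1..n}" if g: "g \<in> carrier P" for g
  proof (rule bij_imp_permutes)
    have "\<tau> (inv\<^bsub>P\<^esub> g) \<circ> \<tau> g = id" "\<tau> g \<circ> \<tau> (inv\<^bsub>P\<^esub> g) = id"
      using \<tau>_mult[of g "inv\<^bsub>P\<^esub> g"] \<tau>_mult[of "inv\<^bsub>P\<^esub> g" g] g \<tau>_one by auto
    then show "bij_betw (\<tau> g) {1..n} {1..n}"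
      using \<tau>_in g by (intro bij_betw_byWitness[where f' = "\<tau> (inv\<^bsub>P\<^esub> g)"]) (auto simp: fun_eq_iff)
  qed (auto simp: \<tau>_def)
  have \<tau>_pow: "\<tau> g ^^ m = \<tau> (g [^]\<^bsub>P\<^esub> m)" if "g \<in> carrier P" for g m
    by (induction m) (use that \<tau>_one \<tau>_mult in auto)
  define \<alpha> where "\<alpha> = \<tau> (letter (Inl (1 mod int p)))"
  define \<phi> where "\<phi> = \<tau> (letter (Inr (1 mod int q)))"
  have gl: "letter (Inl (1 mod int p)) \<in> carrier P" "letter (Inr (1 mod int q)) \<in> carrier P"
    using p q by (auto simp: letters_eq intro!: letter_closed)
  have perm: "\<alpha> permutes {1..n}" "\<phi> permutes {1..n}"
    using \<tau>_perm gl by (auto simp: \<alpha>_def \<phi>_def)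
  have pow: "\<alpha> ^^ m = \<tau> (letter (Inl (int m mod int p)))" "\<phi> ^^ m = \<tau> (letter (Inr (int m mod int q)))" for m
    using \<tau>_pow gl letter_pow[of m] by (simp_all add: \<alpha>_def \<phi>_def)
  \<comment> \<open>Here the freeness of \<open>K\<close> enters: a nontrivial letter fixes no
    dart.\<close>
  have fixpoint: "letter a = \<one>\<^bsub>P\<^esub>" if "a \<in> letters" "i \<in> {1..n}" "\<tau> (letter a) i = i" for a i
  proof (rule semiregular_if_free[OF K d(1)[OF that(2)] that(1)])
    have "e (d i #>\<^bsub>P\<^esub> letter a) = e (d i)" using that d by (simp add: \<tau>_def split: if_splits)
    then show "d i #>\<^bsub>P\<^esub> letter a = d i"
      using de d(1)[OF that(2)] K.coset_closed[OF d(1)[OF that(2)] letter_closed[OF that(1)]] by metis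
  qed
  have "all_cycles_have_length n \<alpha> p"
    unfolding all_cycles_have_length_iff[OF perm(1) p]
  proof (intro ballI conjI allI impI)
    fix i m assume i: "i \<in> {1..n}"
    show "(\<alpha> ^^ p) i = i" using letter_one \<tau>_one by (simp add: pow)
    assume m: "0 < m" "m < p"
    show "(\<alpha> ^^ m) i \<noteq> i"
    proof
      assume "(\<alpha> ^^ m) i = i"
      \<comment> \<open>Distinct residues give distinct elements of \<open>P\<close>, so a return
        after \<open>m < p\<close> steps would force \<open>m = 0\<close>.\<close>
      then have "letter (Inl (int m)) = letter (Inl 0)"
        using fixpoint[of "Inl (int m)" i] i m letter_one by (simp add: pow letters_eq)
      then show False
        using inj_onD[OF inj_letter_Inl, of "int m" 0] m by (simp add: carrier_integer_mod_group)
    qed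
  qed
  moreover have "all_cycles_have_length n \<phi> q"
    unfolding all_cycles_have_length_iff[OF perm(2) q]
  proof (intro ballI conjI allI impI)
    fix i m assume i: "i \<in> {1..n}"
    show "(\<phi> ^^ q) i = i" using letter_one \<tau>_one by (simp add: pow)
    assume m: "0 < m" "m < q"
    show "(\<phi> ^^ m) i \<noteq> i"
    proof
      assume "(\<phi> ^^ m) i = i"
      then have "letter (Inr (int m)) = letter (Inr 0)"
        using fixpoint[of "Inr (int m)" i] i m letter_one by (simp add: pow letters_eq)
      then show False
        using inj_onD[OF inj_letter_Inr, of "int m" 0] m by (simp add: carrier_integer_mod_group)
    qed
  qed
  moreover have "connected_hypermap n (\<alpha>, \<phi>)"
  proof -
    let ?gen = "generate (sym_group n) {\<alpha>, \<phi>}"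
    have gen_pow: "\<pi> ^^ m \<in> ?gen" if "\<pi> \<in> {\<alpha>, \<phi>}" for \<pi> m
    proof (induction m)
      case 0
      then show ?case using generate.one[of "sym_group n"] by (simp add: sym_group_one id_def)
    next
      case (Suc m)
      then show ?case
        using generate.eng[OF generate.incl[OF that] Suc]
        by (simp only: funpow.simps sym_group_mult)
    qed
    have gen: "\<tau> g \<in> ?gen" if "g \<in> carrier P" for g
      using that
    proof (induction rule: P_induct)
      case one
      then show ?case using generate.one[of "sym_group n"] \<tau>_one by (simp only: sym_group_one)
    next
      case (snoc g a)
      have "\<tau> (letter a) \<in> ?gen"
      proof (cases a)
        case (Inl k)
        then show ?thesis using pow(1)[of "nat k"] gen_pow[of \<alpha> "nat k"] snoc by (auto simp: letters_eq)
      next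
        case (Inr k)
        then show ?thesis using pow(2)[of "nat k"] gen_pow[of \<phi> "nat k"] snoc by (auto simp: letters_eq)
      qed
      from generate.eng[OF this snoc.IH] show ?case
        using \<tau>_mult[of g "letter a"] snoc.hyps by (simp only: sym_group_mult letter_closed)
    qed
    have trans: "\<exists>g\<in>carrier P. \<tau> g i = j" if ij: "i \<in> {1..n}" "j \<in> {1..n}" for i j
    proof -
      obtain g where g: "g \<in> carrier P" "d i = K #>\<^bsub>P\<^esub> g" using d(1)[OF ij(1)] by (rule K.coset_cases)
      obtain h where h: "h \<in> carrier P" "d j = K #>\<^bsub>P\<^esub> h" using d(1)[OF ij(2)] by (rule K.coset_cases)
      \<comment> \<open>The inverse of \<open>g\<close> leads from the coset numbered
        \<open>i\<close> to \<open>K\<close>, and \<open>h\<close> leads on to the coset numbered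
        \<open>j\<close>.\<close>
      have "d i #>\<^bsub>P\<^esub> (inv\<^bsub>P\<^esub> g \<otimes>\<^bsub>P\<^esub> h) = K #>\<^bsub>P\<^esub> (g \<otimes>\<^bsub>P\<^esub> (inv\<^bsub>P\<^esub> g \<otimes>\<^bsub>P\<^esub> h))"
        using g h K.K_subset by (simp add: P.coset_mult_assoc)
      also have "g \<otimes>\<^bsub>P\<^esub> (inv\<^bsub>P\<^esub> g \<otimes>\<^bsub>P\<^esub> h) = h" using g h by (simp flip: P.m_assoc)
      finally have "\<tau> (inv\<^bsub>P\<^esub> g \<otimes>\<^bsub>P\<^esub> h) i = e (d j)" using ij h by (simp add: \<tau>_def)
      then show ?thesis using d(2)[OF ij(2)] g h by (intro bexI[of _ "inv\<^bsub>P\<^esub> g \<otimes>\<^bsub>P\<^esub> h"]) auto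
    qed
    show ?thesis
      unfolding connected_hypermap_def prod.case
    proof (intro ballI)
      fix i j assume "i \<in> {1..n}" "j \<in> {1..n}"
      from trans[OF this] obtain g where "g \<in> carrier P" "\<tau> g i = j" by blast
      then show "\<exists>g\<in>?gen. g i = j" using gen by metis
    qed
  qed
  ultimately have hyp: "(\<alpha>, \<phi>) \<in> connected_rooted_hypermaps p q n"
    using n perm by (simp add: connected_rooted_hypermaps_def labelled_hypermaps_def)
  interpret A: rooted_hypermap p q n \<alpha> \<phi> by (rule rooted_hypermapI[OF hyp])
  have step: "e (x #>\<^bsub>P\<^esub> letter a) = hypermap_step (\<alpha>, \<phi>) (e x) a" if "x \<in> ?X" "a \<in> letters" for x a
  proof (cases a)
    case (Inl k)
    then show ?thesis
      using that \<tau>_e[OF that(1)] pow(1)[of "nat k"] by (auto simp: letters_eq hypermap_step_def)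
  next
    case (Inr k)
    then show ?thesis
      using that \<tau>_e[OF that(1)] pow(2)[of "nat k"] by (auto simp: letters_eq hypermap_step_def)
  qed
  have "act (hypermap_step (\<alpha>, \<phi>)) 1 g = e (K #>\<^bsub>P\<^esub> g)" if "g \<in> carrier P" for g
  proof -
    have "e (act (\<lambda>x a. x #>\<^bsub>P\<^esub> letter a) K g) = act (hypermap_step (\<alpha>, \<phi>)) (e K) g"
      using e_in step K_coset that by (intro act_morphism'[OF K.coset_action(1) A.step_action])
    then show ?thesis unfolding eK K.coset_action(2)[OF K_coset that] by (simp only:)
  qed
  moreover have "e (K #>\<^bsub>P\<^esub> g) = 1 \<longleftrightarrow> g \<in> K" if "g \<in> carrier P" for g
    using K.coset_eq_K_iff[OF that] eK de[OF K_coset] de[OF K.coset_closed[OF K_coset that]] by metis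
  ultimately have "hypermap_stabiliser (\<alpha>, \<phi>) = K"
    using K.K_subset by (auto simp: hypermap_stabiliser_def)
  then show ?thesis using hyp by blast
qed

text \<open>Taking the stabiliser of the root is a map whose fibres are the isomorphism classes and
  whose image is the set of free subgroups of index \<open>n\<close>.\<close>

lemma card_free_subgroups_of_index:
  "card (free_subgroups_of_index P n) = card (rooted_hypermap_classes p q n)"
proof -
  let ?C = "connected_rooted_hypermaps p q n" and ?R = "rooted_isomorphism n"
  have "hypermap_stabiliser c = hypermap_stabiliser d \<longleftrightarrow> ?R `` {c} = ?R `` {d}"
    if "c \<in> ?C" "d \<in> ?C" for c d
  proof -
    have "c \<in> labelled_hypermaps n" "d \<in> labelled_hypermaps n"
      using that by (auto simp: connected_rooted_hypermaps_def)
    then show ?thesis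
      using eq_equiv_class_iff[OF equiv_rooted_isomorphism] hypermap_stabiliser_eq_iff that
      by (cases c; cases d) simp
  qed
  then obtain h where "bij_betw h (hypermap_stabiliser ` ?C) ((\<lambda>c. ?R `` {c}) ` ?C)"
    using images_bij_betw[of ?C hypermap_stabiliser "\<lambda>c. ?R `` {c}"] by metis
  moreover have "hypermap_stabiliser ` ?C = free_subgroups_of_index P n"
  proof (rule antisym)
    show "hypermap_stabiliser ` ?C \<subseteq> free_subgroups_of_index P n"
    proof clarify
      fix \<alpha> \<phi> assume c: "(\<alpha>, \<phi>) \<in> ?C"
      then interpret A: rooted_hypermap p q n \<alpha> \<phi> by (rule rooted_hypermapI)
      show "hypermap_stabiliser (\<alpha>, \<phi>) \<in> free_subgroups_of_index P n"
        using A.stabiliser_free_subgroup unfolding hypermap_stabiliser_eq[OF c] .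
    qed
    show "free_subgroups_of_index P n \<subseteq> hypermap_stabiliser ` ?C"
      using ex_hypermap_with_stabiliser by blast
  qed
  moreover have "(\<lambda>c. ?R `` {c}) ` ?C = rooted_hypermap_classes p q n"
    by (auto simp: rooted_hypermap_classes_def quotient_def)
  ultimately show ?thesis by (auto dest: bij_betw_same_card)
qed

end

theorem theorem4p2:
  fixes p q :: nat
  assumes "p * q \<ge> 6"
  shows "(Abs_fps (\<lambda>n. card (free_subgroups_of_index (hypermap_group p q) n)) :: nat fps) =
    Abs_fps (\<lambda>n. card (rooted_hypermap_classes p q n))"
proof -
  interpret hypermap_type p q
    using assms by unfold_locales (auto intro!: Nat.gr0I)
  show ?thesis by (simp add: card_free_subgroups_of_index)
qed

end
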